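(* For $n\ge2$, $$|\mathcal C_n(213,312)|=|\mathcal C_n(132,231)|=\frac1{2n}\sum_{\substack{d\mid n\\ d\text{ odd}}}\mu(d)2^{n/d},\qquad |\mathcal C_n(321,2143,3142)|=\frac1n\sum_{d\mid n}\mu(d)2^{n/d},$$ and $$|\mathcal C_n(123,2413,3412)|=\begin{cases}\displaystyle\frac1n\sum_{d\mid n}\mu(d)2^{n/d}&\text{if }n\not\equiv2\pmod4,\\[2mm] \displaystyle\frac1n\sum_{d\mid n}\mu(d)2^{n/d}+\frac2n\sum_{d\mid \frac n2}\mu(d)2^{n/(2d)}&\text{if }n\equiv2\pmod4,\end{cases}$$ where $\mu$ is the Möbius function.
   Context: A permutation $\tau\in\mathcal S_n$ (one-line notation $\tau_1\dots\tau_n$) contains $\rho\in\mathcal S_m$ if there are indices $i_1<\dots<i_m$ such that $\tau_{i_1}\dots\tau_{i_m}$ is in the same relative order as $\rho_1\dots\rho_m$; otherwise $\tau$ avoids $\rho$. $\mathcal C_n(\rho^{(1)},\rho^{(2)},\dots)$ denotes the set of cyclic permutations of $[n]$ (permutations consisting of a single $n$-cycle) that avoid all the patterns $\rho^{(1)},\rho^{(2)},\dots$.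
   Formalization: The formula for |C_n(123,2413,3412)| is proved for n ≥ 3 only: at n = 2 the printed formula gives 3, while the only cyclic permutation of [2] is 21, so the count is 1. The other three formulas are proved for all n ≥ 2. *)

theory Defs
  imports
    Complex_Main
    "HOL-Combinatorics.Orbits"
    "HOL-Computational_Algebra.Squarefree"
begin

text \<open>
  A permutation of \<open>{1..n}\<close> is a function \<open>\<tau>\<close> with \<open>\<tau> permutes {1..n}\<close>, so that \<open>\<tau> i\<close> is the
  \<open>i\<close>-th entry of its one-line notation. A pattern \<open>\<rho>\<close> is given by its one-line notation, as a
  list; \<open>is\<close> below is the list of positions \<open>i\<^sub>1 < \<dots> < i\<^sub>m\<close> of an occurrence.
\<close>

definition contains_pattern :: "nat \<Rightarrow> (nat \<Rightarrow> nat) \<Rightarrow> nat list \<Rightarrow> bool" where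
  "contains_pattern n \<tau> \<rho> \<longleftrightarrow>
     (\<exists>is. length is = length \<rho> \<and> sorted_wrt (<) is \<and> set is \<subseteq> {1..n} \<and>
        (\<forall>j<length \<rho>. \<forall>k<length \<rho>. \<tau> (is ! j) < \<tau> (is ! k) \<longleftrightarrow> \<rho> ! j < \<rho> ! k))"

definition avoids_pattern :: "nat \<Rightarrow> (nat \<Rightarrow> nat) \<Rightarrow> nat list \<Rightarrow> bool" where
  "avoids_pattern n \<tau> \<rho> \<longleftrightarrow> \<not> contains_pattern n \<tau> \<rho>"

definition cyclic_avoiders :: "nat \<Rightarrow> nat list set \<Rightarrow> (nat \<Rightarrow> nat) set" where
  "cyclic_avoiders n P =
     {\<tau>. \<tau> permutes {1..n} \<and> cyclic_on \<tau> {1..n} \<and> (\<forall>\<rho>\<in>P. avoids_pattern n \<tau> \<rho>)}"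

definition moebius_mu :: "nat \<Rightarrow> int" where
  "moebius_mu d = (if squarefree d then (-1) ^ card (prime_factors d) else 0)"

end

theory Submission
  imports Defs
begin

text \<open>
  Each avoidance class consists of the permutations \<open>\<pi>\<close> that are monotone, with prescribed directions, on
  both \<open>{1..k}\<close> and \<open>{k+1..n}\<close> for some split \<open>k\<close>. Given a cyclic \<open>\<pi>\<close>, a split \<open>k\<close> and a point \<open>x\<close>, record
  for each \<open>i\<close> on which side of the split \<open>\<pi>\<^sup>i(x)\<close> lies. The resulting \<open>n\<close>-periodic binary word determines
  the order of the points \<open>\<pi>\<^sup>i(x)\<close> through a signed lexicographic order, except for points with equal
  itineraries. If the word has a period \<open>m\<close> not divisible by \<open>n\<close>, then \<open>\<pi>\<^sup>m\<close> maps the points with a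
  common itinerary monotonically to each other; it cannot preserve their order, so it reverses it,
  and \<open>\<pi>\<^sup>2\<^sup>m\<close> fixes them. Hence the word is primitive, or it is \<open>u u\<close> with \<open>u\<close> primitive containing an odd
  number of order-reversing letters. Every primitive word arises from exactly one triple \<open>(\<pi>, k, x)\<close>,
  every such \<open>u u\<close> from exactly two. Primitive words are counted by Moebius inversion.
\<close>

section \<open>Moebius inversion\<close>

lemma moebius_mu_prime_mult:
  fixes p d :: nat
  assumes "prime p" "\<not> p dvd d" "d > 0"
  shows "moebius_mu (p * d) = - moebius_mu d"
proof -
  have cop: "coprime p d"
    using assms by (simp add: prime_imp_coprime)
  have "squarefree (p * d) \<longleftrightarrow> squarefree d"
    using squarefree_mult_coprime[OF cop] squarefree_prime[OF assms(1)] squarefree_multD(2) by blast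
  moreover have "prime_factors (p * d) = insert p (prime_factors d)"
    using assms by (simp add: prime_factors_product prime_prime_factors)
  moreover have "p \<notin> prime_factors d"
    using assms by auto
  ultimately show ?thesis
    by (simp add: moebius_mu_def)
qed

text \<open>For a prime \<open>p\<close> dividing \<open>n\<close>, multiplication by
  \<open>p\<close> matches the squarefree divisors prime to \<open>p\<close> with those divisible by
  \<open>p\<close>, and matched terms cancel. Divisors that are not squarefree contribute
  zero.\<close>

lemma sum_moebius_mu_divisors:
  assumes "n > 0"
  shows "(\<Sum>d | d dvd n. moebius_mu d) = (if n = 1 then 1 else 0)"
proof (cases "n = 1")
  case False
  then obtain p where p: "prime p" "p dvd n"
    using prime_factor_nat by blast
  have fin: "finite {d. d dvd n}"
    using assms by simp
  define A where "A = {d. d dvd n \<and> squarefree d \<and> \<not> p dvd d}"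
  define B where "B = {d. d dvd n \<and> squarefree d \<and> p dvd d}"
  have "(\<Sum>d | d dvd n. moebius_mu d) = (\<Sum>d\<in>A \<union> B. moebius_mu d)"
    by (rule sum.mono_neutral_right[OF fin]) (auto simp: A_def B_def moebius_mu_def)
  also have "\<dots> = sum moebius_mu A + sum moebius_mu B"
    by (rule sum.union_disjoint) (use fin in \<open>auto simp: A_def B_def\<close>)
  finally have split: "(\<Sum>d | d dvd n. moebius_mu d) = sum moebius_mu A + sum moebius_mu B" .
  have "bij_betw ((*) p) A B"
  proof (rule bij_betwI')
    fix x y show "p * x = p * y \<longleftrightarrow> x = y"
      using p prime_gt_0_nat by simp
  next
    fix x assume x: "x \<in> A"
    then have cop: "coprime p x"
      using p by (simp add: A_def prime_imp_coprime)
    have "p * x dvd n"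
      using x p cop by (simp add: A_def divides_mult)
    moreover have "squarefree (p * x)"
      using x p cop by (auto simp: A_def intro: squarefree_mult_coprime squarefree_prime)
    ultimately show "p * x \<in> B"
      by (simp add: B_def)
  next
    fix y assume y: "y \<in> B"
    then obtain x where x: "y = p * x"
      by (auto simp: B_def)
    have "\<not> p dvd x"
    proof
      assume "p dvd x"
      then have "p ^ 2 dvd y"
        using x by (auto simp: power2_eq_square)
      then show False
        using y p squarefreeD not_prime_unit unfolding B_def by blast
    qed
    moreover have "x dvd n" "squarefree x"
      using y x by (auto simp: B_def dest: dvd_mult_right squarefree_multD(2))
    ultimately show "\<exists>x\<in>A. y = p * x"
      using x by (auto simp: A_def)
  qed
  then have "sum moebius_mu B = (\<Sum>d\<in>A. moebius_mu (p * d))"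
    by (rule sum.reindex_bij_betw[symmetric])
  also have "\<dots> = (\<Sum>d\<in>A. - moebius_mu d)"
    by (rule sum.cong) (use p assms in \<open>auto simp: A_def moebius_mu_prime_mult dvd_pos_nat\<close>)
  finally show ?thesis
    using False split by (simp add: sum_negf)
qed (simp add: moebius_mu_def)

text \<open>Inversion for divisor sums that admit only quotients \<open>m div d\<close> satisfying a
  completely multiplicative \<open>Q\<close>. It serves with trivial \<open>Q\<close> for all words
  and with \<open>Q = odd\<close> for words of odd parity, because a repetition of a word has odd
  parity only if the word has and the number of copies is odd.\<close>

lemma moebius_inversion_restricted:
  fixes f g :: "nat \<Rightarrow> real" and Q :: "nat \<Rightarrow> bool"
  assumes Q: "\<And>a b. Q (a * b) \<longleftrightarrow> Q a \<and> Q b"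
    and g: "\<And>m. m > 0 \<Longrightarrow> g m = (\<Sum>d | d dvd m \<and> Q (m div d). f d)"
    and Q1: "Q 1" and n: "n > 0"
  shows "f n = (\<Sum>e | e dvd n \<and> Q e. real_of_int (moebius_mu e) * g (n div e))"
proof -
  let ?\<mu> = "\<lambda>e. real_of_int (moebius_mu e)"
  have fin: "finite {d. d dvd m \<and> P d}" if "m > 0" for m :: nat and P
    by (rule finite_subset[OF _ finite_divisors_nat[OF that]]) auto
  have pos: "n div e > 0" if "e dvd n" for e
    using that n by auto
  have "(\<Sum>e | e dvd n \<and> Q e. ?\<mu> e * g (n div e)) =
        (\<Sum>e | e dvd n \<and> Q e. \<Sum>d | d dvd n div e \<and> Q (n div e div d). ?\<mu> e * f d)"
    by (intro sum.cong) (simp_all add: g pos sum_distrib_left)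
  also have "\<dots> = (\<Sum>(e, d) \<in> (SIGMA e:{e. e dvd n \<and> Q e}. {d. d dvd n div e \<and> Q (n div e div d)}).
                     ?\<mu> e * f d)"
    by (rule sum.Sigma) (use n in \<open>simp_all add: fin pos\<close>)
  \<comment> \<open>Writing \<open>n = e * d * k\<close>, the two conditions \<open>Q e\<close> and
    \<open>Q k\<close> amount to \<open>Q (e * k)\<close>, a condition on \<open>d\<close> alone.
    After the exchange the inner sum therefore runs over all divisors \<open>e\<close> of
    \<open>n div d\<close>.\<close>
  also have "\<dots> = (\<Sum>(d, e) \<in> (SIGMA d:{d. d dvd n \<and> Q (n div d)}. {e. e dvd n div d}).
                     ?\<mu> e * f d)"
  proof (rule sum.reindex_bij_witness[where i = "\<lambda>(d, e). (e, d)" and j = "\<lambda>(e, d). (d, e)"], goal_cases)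
    case (2 a)
    obtain e d where a: "a = (e, d)" by (cases a)
    with 2 have "e dvd n" "d dvd n div e" "Q e" "Q (n div e div d)"
      by auto
    moreover from this obtain k where "n = e * (d * k)"
      using n by (metis dvd_def dvd_mult_div_cancel)
    ultimately have "n = e * (d * k)" "Q e" "Q k" "e > 0" "d > 0"
      using n by auto
    then show ?case
      using a Q by (auto simp: mult.left_commute[of e d])
  next
    case (4 a)
    obtain d e where a: "a = (d, e)" by (cases a)
    with 4 have "d dvd n" "e dvd n div d" "Q (n div d)"
      by auto
    moreover from this obtain k where "n = d * (e * k)"
      using n by (metis dvd_def dvd_mult_div_cancel)
    ultimately have "n = d * (e * k)" "Q (e * k)" "e > 0" "d > 0"
      using n by auto
    then show ?case
      using a Q by (auto simp: mult.left_commute[of d e])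
  qed auto
  also have "\<dots> = (\<Sum>d | d dvd n \<and> Q (n div d). \<Sum>e | e dvd n div d. ?\<mu> e * f d)"
    by (rule sum.Sigma[symmetric]) (use n in \<open>simp_all add: fin pos\<close>)
  also have "\<dots> = (\<Sum>d | d dvd n \<and> Q (n div d). if d = n then f n else 0)"
  proof (rule sum.cong, goal_cases)
    case (2 d)
    then obtain k where k: "n = d * k" by auto
    with n have pos: "d > 0" "k > 0" by auto
    have "(\<Sum>e | e dvd n div d. ?\<mu> e * f d) = real_of_int (\<Sum>e | e dvd k. moebius_mu e) * f d"
      using k pos by (simp add: sum_distrib_right)
    also have "\<dots> = (if d = n then f n else 0)"
      using k pos by (auto simp: sum_moebius_mu_divisors)
    finally show ?case .
  qed simp
  also have "\<dots> = f n"
    using n Q1 by (simp add: fin sum.delta)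
  finally show ?thesis ..
qed

section \<open>Periodic words\<close>

definition period :: "nat \<Rightarrow> (nat \<Rightarrow> bool) \<Rightarrow> bool" where
  "period m w \<longleftrightarrow> (\<forall>i. w (i + m) = w i)"

text \<open>A primitive word of length \<open>n\<close> is represented by its infinite repetition,
  so that rotations become shifts and itineraries are words as they stand.\<close>

definition primitive :: "nat \<Rightarrow> (nat \<Rightarrow> bool) \<Rightarrow> bool" where
  "primitive n w \<longleftrightarrow> n > 0 \<and> (\<forall>m. period m w \<longleftrightarrow> n dvd m)"

text \<open>Parity of the number of order-reversing letters among the first \<open>i\<close> letters of \<open>w\<close>;
  \<open>\<sigma> c\<close> says that the letter \<open>c\<close> is order-reversing.\<close>

primrec par :: "(bool \<Rightarrow> bool) \<Rightarrow> (nat \<Rightarrow> bool) \<Rightarrow> nat \<Rightarrow> bool" where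
  "par \<sigma> w 0 = False"
| "par \<sigma> w (Suc i) = (par \<sigma> w i \<noteq> \<sigma> (w i))"

lemma period_0 [simp]: "period 0 w"
  by (simp add: period_def)

lemma period_add: "period a w \<Longrightarrow> period b w \<Longrightarrow> period (a + b) w"
  by (metis period_def add.assoc)

lemma period_add_cancel: "period a w \<Longrightarrow> period (b + a) w \<Longrightarrow> period b w"
  by (metis period_def add.assoc)

lemma period_mult: "period a w \<Longrightarrow> period (q * a) w"
  by (induction q) (auto intro: period_add)

lemma period_mod: "period a w \<Longrightarrow> period b w \<Longrightarrow> period (b mod a) w"
  by (metis div_mult_mod_eq add.commute period_mult period_add_cancel)

lemma period_eq_mod: "period n w \<Longrightarrow> w (i mod n) = w i"
  by (metis mod_mult_div_eq mult.commute period_def period_mult)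

lemma primitive_period: "primitive n w \<Longrightarrow> period n w"
  by (simp add: primitive_def)

lemma period_imp_primitive_divisor:
  assumes "n > 0" "period n w"
  obtains d where "d dvd n" "primitive d w"
proof -
  define d where "d = (LEAST d. d > 0 \<and> period d w)"
  have d: "d > 0" "period d w" and least: "\<And>m. m > 0 \<Longrightarrow> period m w \<Longrightarrow> d \<le> m"
    using LeastI[of "\<lambda>d. d > 0 \<and> period d w" n] Least_le[of "\<lambda>d. d > 0 \<and> period d w"] assms
    by (auto simp: d_def)
  have "d dvd m" if "period m w" for m
    using least[of "m mod d"] period_mod[OF d(2) that] d(1)
    by (metis dvd_eq_mod_eq_0 mod_less_divisor not_gr_zero not_le)
  then have "primitive d w"
    using d period_mult by (auto simp: primitive_def mult.commute[of d])
  with that assms show thesis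
    by (simp add: primitive_def)
qed

lemma primitive_unique: "primitive a w \<Longrightarrow> primitive b w \<Longrightarrow> a = b"
  unfolding primitive_def by (metis dvd_antisym dvd_refl)

lemma par_add_period:
  assumes "period m w"
  shows "par \<sigma> w (i + m) = (par \<sigma> w i \<noteq> par \<sigma> w m)"
  using assms by (induction i) (auto simp: period_def)

lemma par_mult_period:
  assumes "period m w"
  shows "par \<sigma> w (q * m) = (odd q \<and> par \<sigma> w m)"
proof (induction q)
  case (Suc q)
  then show ?case
    using par_add_period[OF assms, of \<sigma> "q * m"] by (auto simp: add.commute)
qed simp

lemma par_eq_odd_card: "par \<sigma> w i = odd (card {j. j < i \<and> \<sigma> (w j)})"
proof (induction i)
  case (Suc i)
  have "{j. j < Suc i \<and> \<sigma> (w j)} = {j. j < i \<and> \<sigma> (w j)} \<union> (if \<sigma> (w i) then {i} else {})"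
    by (auto simp: less_Suc_eq)
  then show ?case
    using Suc by simp
qed simp

lemma par_True: "par (\<lambda>_. True) w i = odd i"
  and par_False: "par (\<lambda>_. False) w i = False"
  by (induction i) auto

section \<open>Counting periodic and primitive words\<close>

lemma bij_betw_periodic_Pow:
  assumes "n > 0"
  shows "bij_betw (\<lambda>w. {i. i < n \<and> w i}) {w. period n w} (Pow {..<n})"
proof (rule bij_betw_byWitness[where f' = "\<lambda>A i. i mod n \<in> A"])
  show "\<forall>w\<in>{w. period n w}. (\<lambda>i. i mod n \<in> {i. i < n \<and> w i}) = w"
    using assms by (auto simp: period_eq_mod)
qed (use assms in \<open>auto simp: period_def\<close>)

lemma finite_periodic: "n > 0 \<Longrightarrow> finite {w. period n w}"
  and card_periodic: "n > 0 \<Longrightarrow> card {w. period n w} = 2 ^ n"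
  using bij_betw_finite[OF bij_betw_periodic_Pow] bij_betw_same_card[OF bij_betw_periodic_Pow]
  by (auto simp: card_Pow)

text \<open>Toggling the letters at multiples of \<open>n\<close> changes one letter per period. As
  \<open>\<sigma>\<close> separates the two letters, this involution swaps odd and even parity, so
  exactly half of the \<open>2 ^ n\<close> words are odd.\<close>

lemma card_periodic_odd:
  assumes n: "n > 0" and \<sigma>: "\<And>c. \<sigma> (\<not> c) = (\<not> \<sigma> c)"
  shows "card {w. period n w \<and> par \<sigma> w n} = 2 ^ (n - 1)"
proof -
  define flip where "flip w i = (if n dvd i then \<not> w i else w i)" for w i
  have flip_flip: "flip (flip w) = w" for w
    by (rule ext) (simp add: flip_def)
  have per: "period n (flip w)" if "period n w" for w
    using that by (auto simp: period_def flip_def)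
  have "par \<sigma> (flip w) (Suc j) = (\<not> par \<sigma> w (Suc j))" if "j < n" for w j
    using that
  proof (induction j)
    case (Suc j)
    then have "flip w (Suc j) = w (Suc j)"
      by (auto simp: flip_def dest: dvd_imp_le)
    with Suc show ?case
      by auto
  qed (simp add: flip_def \<sigma>)
  from this[of "n - 1"] have par: "par \<sigma> (flip w) n = (\<not> par \<sigma> w n)" for w
    using n by simp
  have "bij_betw flip {w. period n w \<and> par \<sigma> w n} {w. period n w \<and> \<not> par \<sigma> w n}"
    by (rule bij_betw_byWitness[where f' = flip]) (auto simp: flip_flip par per)
  then have "card {w. period n w \<and> par \<sigma> w n} = card {w. period n w \<and> \<not> par \<sigma> w n}"
    by (rule bij_betw_same_card)
  moreover have "card {w. period n w} =
      card {w. period n w \<and> par \<sigma> w n} + card {w. period n w \<and> \<not> par \<sigma> w n}"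
    using finite_periodic[OF n]
    by (subst card_Un_disjoint[symmetric]) (auto intro!: arg_cong[where f = card])
  ultimately have "2 * card {w. period n w \<and> par \<sigma> w n} = 2 ^ n"
    using n by (simp add: card_periodic)
  also have "\<dots> = 2 * 2 ^ (n - 1)"
    using n by (simp flip: power_Suc)
  finally show ?thesis
    by simp
qed

lemma finite_primitive: "finite {w. primitive n w \<and> P w}"
  by (cases "n = 0")
    (auto simp: primitive_def intro: finite_subset[OF _ finite_periodic[of n]])

text \<open>Every \<open>n\<close>-periodic word is the repetition of exactly one primitive word,
  whose length \<open>d\<close> divides \<open>n\<close>. The assumption on \<open>P\<close>
  separates a condition on that primitive word from a condition on the number of copies.\<close>

lemma card_periodic_eq_sum_primitive:
  assumes "n > 0"
    and P: "\<And>d w. d dvd n \<Longrightarrow> primitive d w \<Longrightarrow> P n w \<longleftrightarrow> P d w \<and> Q (n div d)"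
  shows "card {w. period n w \<and> P n w} = (\<Sum>d | d dvd n \<and> Q (n div d). card {w. primitive d w \<and> P d w})"
proof -
  have "{w. period n w \<and> P n w} = (\<Union>d\<in>{d. d dvd n \<and> Q (n div d)}. {w. primitive d w \<and> P d w})"
  proof (intro equalityI subsetI)
    fix w assume w: "w \<in> {w. period n w \<and> P n w}"
    then obtain d where "d dvd n" "primitive d w"
      using period_imp_primitive_divisor[OF assms(1)] by blast
    with w P show "w \<in> (\<Union>d\<in>{d. d dvd n \<and> Q (n div d)}. {w. primitive d w \<and> P d w})"
      by blast
  qed (use P in \<open>auto simp: primitive_def\<close>)
  also have "card \<dots> = (\<Sum>d | d dvd n \<and> Q (n div d). card {w. primitive d w \<and> P d w})"
    by (rule card_UN_disjoint) (use assms in \<open>auto simp: finite_primitive dest: primitive_unique\<close>)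
  finally show ?thesis .
qed

lemma card_primitive:
  assumes "n > 0"
  shows "real (card {w. primitive n w}) = (\<Sum>d | d dvd n. real_of_int (moebius_mu d) * 2 ^ (n div d))"
proof -
  have "real (card {w. period m w}) = (\<Sum>d | d dvd m \<and> True. real (card {w. primitive d w}))"
    if "m > 0" for m
    using card_periodic_eq_sum_primitive[OF that, of "\<lambda>_ _. True" "\<lambda>_. True"] by simp
  then have "real (card {w. primitive n w}) =
      (\<Sum>d | d dvd n \<and> True. real_of_int (moebius_mu d) * real (card {w. period (n div d) w}))"
    by (intro moebius_inversion_restricted) (use assms in auto)
  also have "\<dots> = (\<Sum>d | d dvd n. real_of_int (moebius_mu d) * 2 ^ (n div d))"
    using assms by (intro sum.cong) (auto simp: card_periodic elim: dvdE)
  finally show ?thesis .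
qed

lemma card_primitive_odd:
  assumes "n > 0" and \<sigma>: "\<And>c. \<sigma> (\<not> c) = (\<not> \<sigma> c)"
  shows "real (card {w. primitive n w \<and> par \<sigma> w n}) =
    1 / 2 * (\<Sum>d | d dvd n \<and> odd d. real_of_int (moebius_mu d) * 2 ^ (n div d))"
proof -
  have "par \<sigma> w m \<longleftrightarrow> par \<sigma> w d \<and> odd (m div d)" if "d dvd m" "primitive d w" for d m w
    using par_mult_period[OF primitive_period[OF that(2)], of \<sigma> "m div d"] that(1) by auto
  then have "real (card {w. period m w \<and> par \<sigma> w m}) =
      (\<Sum>d | d dvd m \<and> odd (m div d). real (card {w. primitive d w \<and> par \<sigma> w d}))"
    if "m > 0" for m
    using card_periodic_eq_sum_primitive[OF that, of "\<lambda>d w. par \<sigma> w d" odd] by simp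
  then have "real (card {w. primitive n w \<and> par \<sigma> w n}) =
      (\<Sum>d | d dvd n \<and> odd d. real_of_int (moebius_mu d) *
        real (card {w. period (n div d) w \<and> par \<sigma> w (n div d)}))"
    by (intro moebius_inversion_restricted) (use assms in auto)
  also have "\<dots> = (\<Sum>d | d dvd n \<and> odd d. 1 / 2 * (real_of_int (moebius_mu d) * 2 ^ (n div d)))"
  proof (rule sum.cong, goal_cases)
    case (2 d)
    then have "n div d > 0"
      using assms by (auto elim: dvdE)
    then show ?case
      using card_periodic_odd[of "n div d" \<sigma>] \<sigma> by (cases "n div d") (auto simp del: par.simps)
  qed simp
  finally show ?thesis
    by (simp add: sum_distrib_left)
qed

section \<open>The signed lexicographic order\<close>

text \<open>At the first difference \<open>j\<close>, the last conjunct gives the letter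
  \<open>True\<close> to \<open>t\<close> if the common prefix has even parity and to
  \<open>s\<close> if it has odd parity: each reversing letter of the prefix flips the
  comparison.\<close>

definition sless :: "(bool \<Rightarrow> bool) \<Rightarrow> (nat \<Rightarrow> bool) \<Rightarrow> (nat \<Rightarrow> bool) \<Rightarrow> bool" where
  "sless \<sigma> s t \<longleftrightarrow> (\<exists>j. (\<forall>i<j. s i = t i) \<and> s j \<noteq> t j \<and> t j \<noteq> par \<sigma> s j)"

lemma par_cong: "(\<And>i. i < j \<Longrightarrow> s i = t i) \<Longrightarrow> par \<sigma> s j = par \<sigma> t j"
  by (induction j) auto

lemma first_difference:
  assumes "s \<noteq> (t :: nat \<Rightarrow> bool)"
  obtains j where "\<And>i. i < j \<Longrightarrow> s i = t i" "s j \<noteq> t j"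
  using assms exists_least_iff[of "\<lambda>j. s j \<noteq> t j"] by blast

lemma sless_at:
  assumes "\<And>i. i < j \<Longrightarrow> s i = t i" "s j \<noteq> t j"
  shows "sless \<sigma> s t \<longleftrightarrow> t j \<noteq> par \<sigma> s j"
proof -
  have "l = j" if "\<forall>i<l. s i = t i" "s l \<noteq> t l" for l
    using assms that by (metis linorder_neqE_nat)
  then show ?thesis
    using assms unfolding sless_def by metis
qed

lemma sless_irrefl [simp]: "\<not> sless \<sigma> s s"
  by (simp add: sless_def)

lemma sless_total:
  assumes "s \<noteq> t"
  shows "sless \<sigma> s t \<longleftrightarrow> \<not> sless \<sigma> t s"
proof -
  obtain j where j: "\<And>i. i < j \<Longrightarrow> s i = t i" "s j \<noteq> t j"
    using first_difference[OF assms] by blast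
  have "par \<sigma> s j = par \<sigma> t j"
    using j(1) by (rule par_cong)
  then show ?thesis
    using sless_at[of j s t \<sigma>] sless_at[of j t s \<sigma>] j by metis
qed

lemma sless_trans:
  assumes "sless \<sigma> s t" "sless \<sigma> t u"
  shows "sless \<sigma> s u"
proof -
  obtain j where j: "\<And>i. i < j \<Longrightarrow> s i = t i" "s j \<noteq> t j" "t j \<noteq> par \<sigma> s j"
    using assms(1) unfolding sless_def by blast
  obtain l where l: "\<And>i. i < l \<Longrightarrow> t i = u i" "t l \<noteq> u l" "u l \<noteq> par \<sigma> t l"
    using assms(2) unfolding sless_def by blast
  have *: "par \<sigma> s l = par \<sigma> t l" if "l \<le> j"
    by (rule par_cong) (use j that in auto)
  consider "j < l" | "l < j" | "j = l" by linarith
  then show ?thesis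
  proof cases
    case 1
    then show ?thesis
      unfolding sless_def using j l by (intro exI[of _ j]) (metis less_trans)
  next
    case 2
    then show ?thesis
      unfolding sless_def using j l * by (intro exI[of _ l]) (metis less_trans less_imp_le)
  next
    \<comment> \<open>Impossible for a two-letter alphabet: \<open>t j\<close> and
      \<open>u j\<close> both differ from the same parity, so they are equal.\<close>
    case 3
    then show ?thesis
      using j l * by auto
  qed
qed

lemma sless_0: "s 0 \<noteq> t 0 \<Longrightarrow> sless \<sigma> s t = t 0"
  using sless_at[of 0 s t] by simp

lemma par_Suc_shift: "par \<sigma> s (Suc j) = (\<sigma> (s 0) \<noteq> par \<sigma> (\<lambda>i. s (Suc i)) j)"
  by (induction j) auto

text \<open>The first difference moves one place to the left, and its sign loses the contribution of
  the deleted common letter.\<close>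

lemma sless_Suc_shift:
  assumes "s 0 = t 0" "s \<noteq> t"
  shows "sless \<sigma> (\<lambda>i. s (Suc i)) (\<lambda>i. t (Suc i)) = (sless \<sigma> s t \<noteq> \<sigma> (s 0))"
proof -
  obtain j where j: "\<And>i. i < j \<Longrightarrow> s i = t i" "s j \<noteq> t j"
    using first_difference[OF assms(2)] by blast
  with assms(1) obtain l where l: "j = Suc l"
    by (cases j) auto
  have "sless \<sigma> (\<lambda>i. s (Suc i)) (\<lambda>i. t (Suc i)) = (t (Suc l) \<noteq> par \<sigma> (\<lambda>i. s (Suc i)) l)"
    by (rule sless_at) (use j l in auto)
  moreover have "sless \<sigma> s t = (t j \<noteq> par \<sigma> s j)"
    by (rule sless_at) (use j in auto)
  ultimately show ?thesis
    unfolding l par_Suc_shift by auto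
qed

section \<open>Codes\<close>

text \<open>The second alternative describes the words \<open>u u\<close> and leaves
  \<open>b\<close> free, so each of them yields two codes; a primitive word has its bit fixed to
  \<open>False\<close> and yields one.\<close>

definition codes :: "(bool \<Rightarrow> bool) \<Rightarrow> nat \<Rightarrow> ((nat \<Rightarrow> bool) \<times> bool) set" where
  "codes \<sigma> n = {(w, b). primitive n w \<and> \<not> b \<or>
     even n \<and> primitive (n div 2) w \<and> par \<sigma> w (n div 2)}"

definition shift :: "(nat \<Rightarrow> bool) \<Rightarrow> nat \<Rightarrow> nat \<Rightarrow> bool" where
  "shift w i = (\<lambda>t. w (t + i))"

text \<open>A word \<open>u u\<close> with \<open>u\<close> primitive has pairs of equal rotations; the bit \<open>b\<close> decides which one of
  the first pair is the smaller one, and the parity carries this choice along the word.\<close>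

definition tiebreak :: "(bool \<Rightarrow> bool) \<Rightarrow> nat \<Rightarrow> (nat \<Rightarrow> bool) \<Rightarrow> bool \<Rightarrow> nat \<Rightarrow> bool" where
  "tiebreak \<sigma> n w b i \<longleftrightarrow> \<not> primitive n w \<and> b \<noteq> par \<sigma> w i"

definition rot_less :: "(bool \<Rightarrow> bool) \<Rightarrow> nat \<Rightarrow> (nat \<Rightarrow> bool) \<Rightarrow> bool \<Rightarrow> nat \<Rightarrow> nat \<Rightarrow> bool" where
  "rot_less \<sigma> n w b i j \<longleftrightarrow> sless \<sigma> (shift w i) (shift w j) \<or>
     shift w i = shift w j \<and> \<not> tiebreak \<sigma> n w b i \<and> tiebreak \<sigma> n w b j"

text \<open>This is the value that the \<open>i\<close>-th iterate of the base point must take in a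
  cycle with code \<open>(w, b)\<close>; \<open>Suc\<close> appears because the points are numbered
  from 1.\<close>

definition rot_rank :: "(bool \<Rightarrow> bool) \<Rightarrow> nat \<Rightarrow> (nat \<Rightarrow> bool) \<Rightarrow> bool \<Rightarrow> nat \<Rightarrow> nat" where
  "rot_rank \<sigma> n w b i = Suc (card {j. j < n \<and> rot_less \<sigma> n w b j i})"

lemma shift_eq_imp_period:
  assumes "period n w" "n > 0" "shift w i = shift w j" "i \<le> j"
  shows "period (j - i) w"
  unfolding period_def
proof
  fix t
  \<comment> \<open>Adding the period \<open>n * i\<close> first keeps the subtraction of
    \<open>i\<close> exact in the natural numbers.\<close>
  define t' where "t' = t + (n * i - i)"
  have "i \<le> n * i"
    using assms(2) by simp
  then have t': "t' + i = t + i * n" "t' + j = (t + (j - i)) + i * n"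
    unfolding t'_def mult.commute[of i] using assms(4) by linarith+
  have "w (t' + i) = w (t' + j)"
    using assms(3) by (auto simp: shift_def dest: fun_cong)
  then show "w (t + (j - i)) = w t"
    using period_mult[OF assms(1), of i] unfolding t' period_def by simp
qed

section \<open>Ordering and ranking the rotations of a coded word\<close>

locale code =
  fixes \<sigma> :: "bool \<Rightarrow> bool" and n :: nat and w :: "nat \<Rightarrow> bool" and b :: bool
  assumes code: "(w, b) \<in> codes \<sigma> n"
begin

lemma n_pos: "n > 0" and period_n: "period n w"
proof -
  have "primitive n w \<or> even n \<and> primitive (n div 2) w"
    using code by (auto simp: codes_def)
  then have "n > 0 \<and> period n w"
  proof
    assume "even n \<and> primitive (n div 2) w"
    then have "n = 2 * (n div 2)" "n div 2 > 0" "period (n div 2) w"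
      by (simp_all add: primitive_def)
    then show ?thesis
      using period_mult[of "n div 2" w 2] by simp
  qed (simp add: primitive_def)
  then show "n > 0" "period n w"
    by blast+
qed

lemma not_primitiveD:
  assumes "\<not> primitive n w"
  shows "even n" "primitive (n div 2) w" "par \<sigma> w (n div 2)" "\<not> par \<sigma> w n"
  using code assms par_mult_period[OF primitive_period, of "n div 2" w \<sigma> 2]
  by (auto simp: codes_def)

text \<open>Equal rotations give the period \<open>j - i\<close>, which is below \<open>n\<close>,
  so \<open>w\<close> is some \<open>u u\<close>. This period is then a multiple of
  \<open>n div 2\<close> strictly between \<open>0\<close> and \<open>n\<close>.\<close>

lemma shift_eqD:
  assumes "shift w i = shift w j" "i < j" "j < n"
  shows "\<not> primitive n w" "j = i + n div 2"
proof -
  have per: "period (j - i) w"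
    using shift_eq_imp_period[OF period_n n_pos assms(1)] assms(2) by simp
  then show np: "\<not> primitive n w"
    using assms by (metis dvd_imp_le le_less_trans less_imp_diff_less less_irrefl primitive_def zero_less_diff)
  note D = not_primitiveD[OF np]
  have "n div 2 dvd j - i"
    using per D(2) by (simp add: primitive_def)
  then obtain c where c: "j - i = n div 2 * c" ..
  have "n = n div 2 * 2"
    using D(1) by simp
  then have "n div 2 * c < n div 2 * 2"
    using c assms by linarith
  then have "c < 2"
    by simp
  moreover have "c \<noteq> 0"
    using c assms by (metis mult_0_right not_less0 zero_less_diff)
  ultimately have "c = 1" by simp
  then show "j = i + n div 2"
    using c assms by simp
qed

text \<open>Here the odd parity of \<open>u\<close> is essential: it flips the tiebreak after half a
  turn, so two equal rotations always receive opposite values. The even parity of \<open>u u\<close>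
  makes the tiebreak consistent after a full turn.\<close>

lemma tiebreak_half:
  assumes "\<not> primitive n w"
  shows "tiebreak \<sigma> n w b (i + n div 2) = (\<not> tiebreak \<sigma> n w b i)"
  using not_primitiveD[OF assms] assms par_add_period[OF primitive_period, of "n div 2" w \<sigma> i]
  by (auto simp: tiebreak_def)

lemma shift_add_n: "shift w (i + n) = shift w i"
  using period_n unfolding shift_def period_def by (metis add.assoc)

lemma tiebreak_add_n: "tiebreak \<sigma> n w b (i + n) = tiebreak \<sigma> n w b i"
  using not_primitiveD(4) par_add_period[OF period_n, of \<sigma> i] by (auto simp: tiebreak_def)

lemma rot_less_mod: "rot_less \<sigma> n w b (i mod n) (j mod n) = rot_less \<sigma> n w b i j"
proof -
  have "shift w (i + q * n) = shift w i \<and> tiebreak \<sigma> n w b (i + q * n) = tiebreak \<sigma> n w b i" for i q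
  proof (induction q)
    case (Suc q)
    then show ?case
      using shift_add_n[of "i + q * n"] tiebreak_add_n[of "i + q * n"] by (simp add: ac_simps)
  qed simp
  from this[of "i mod n" "i div n"] this[of "j mod n" "j div n"] show ?thesis
    by (simp add: rot_less_def)
qed

lemma rank_add_n: "rot_rank \<sigma> n w b (i + n) = rot_rank \<sigma> n w b i"
  by (simp add: rot_rank_def rot_less_def shift_add_n tiebreak_add_n)

lemma rank_mod: "rot_rank \<sigma> n w b (i mod n) = rot_rank \<sigma> n w b i"
proof -
  have "rot_rank \<sigma> n w b (i + q * n) = rot_rank \<sigma> n w b i" for i q
    using rank_add_n[of "i + q * n" for q] by (induction q) (simp_all add: ac_simps)
  from this[of "i mod n" "i div n"] show ?thesis by simp
qed

lemma rot_less_irrefl: "\<not> rot_less \<sigma> n w b i i"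
  by (auto simp: rot_less_def)

lemma rot_less_trans: "rot_less \<sigma> n w b i j \<Longrightarrow> rot_less \<sigma> n w b j l \<Longrightarrow> rot_less \<sigma> n w b i l"
  by (auto simp: rot_less_def intro: sless_trans)

lemma rot_less_total:
  assumes "i < n" "j < n" "i \<noteq> j"
  shows "rot_less \<sigma> n w b i j \<longleftrightarrow> \<not> rot_less \<sigma> n w b j i"
proof (cases "shift w i = shift w j")
  case True
  then have "tiebreak \<sigma> n w b i \<longleftrightarrow> \<not> tiebreak \<sigma> n w b j"
    using shift_eqD[of i j] shift_eqD[of j i] tiebreak_half assms by (metis linorder_neqE_nat)
  then show ?thesis
    using True by (auto simp: rot_less_def)
next
  case False
  then show ?thesis
    using sless_total[OF False, of \<sigma>] by (auto simp: rot_less_def)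
qed

lemma rot_less_letters: "w i \<noteq> w j \<Longrightarrow> rot_less \<sigma> n w b i j \<longleftrightarrow> w j"
  unfolding rot_less_def using sless_0[of "shift w i" "shift w j" \<sigma>] by (metis add_0 shift_def)

text \<open>This is what becomes monotonicity of the reconstructed cycle on each side of the split.
  For equal rotations both tiebreaks change by \<open>\<sigma> (w i)\<close>, just as the sign of
  \<open>sless\<close> does for different ones.\<close>

lemma rot_less_Suc:
  assumes "w i = w j" "i < n" "j < n" "i \<noteq> j"
  shows "rot_less \<sigma> n w b (Suc i) (Suc j) = (rot_less \<sigma> n w b i j \<noteq> \<sigma> (w i))"
proof (cases "shift w i = shift w j")
  case True
  then have "tiebreak \<sigma> n w b i \<longleftrightarrow> \<not> tiebreak \<sigma> n w b j" "\<not> primitive n w"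
    using shift_eqD[of i j] shift_eqD[of j i] tiebreak_half assms by (metis linorder_neqE_nat)+
  moreover have "shift w (Suc i) = shift w (Suc j)"
    using True by (auto simp: shift_def fun_eq_iff simp flip: add_Suc)
  ultimately show ?thesis
    using True assms by (auto simp: rot_less_def tiebreak_def)
next
  case False
  have "shift w (Suc i) = (\<lambda>t. shift w i (Suc t))" for i
    by (simp add: shift_def)
  moreover have "shift w (Suc i) \<noteq> shift w (Suc j)"
  proof
    assume *: "shift w (Suc i) = shift w (Suc j)"
    have "shift w i t = shift w j t" for t
      using assms(1) fun_cong[OF *, of "t - 1"] by (cases t) (auto simp: shift_def)
    with False show False by auto
  qed
  ultimately show ?thesis
    using sless_Suc_shift[of "shift w i" "shift w j" \<sigma>] False assms(1)
    by (auto simp: rot_less_def shift_def)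
qed

lemma rank_less_iff:
  assumes "i < n" "j < n"
  shows "rot_rank \<sigma> n w b i < rot_rank \<sigma> n w b j \<longleftrightarrow> rot_less \<sigma> n w b i j"
proof -
  have *: "rot_rank \<sigma> n w b i < rot_rank \<sigma> n w b j" if "rot_less \<sigma> n w b i j" "i < n" for i j
  proof -
    have "{l. l < n \<and> rot_less \<sigma> n w b l i} \<subset> {l. l < n \<and> rot_less \<sigma> n w b l j}"
      using that rot_less_irrefl rot_less_trans by blast
    then show ?thesis
      by (simp add: rot_rank_def psubset_card_mono)
  qed
  show ?thesis
    using *[of i j] *[of j i] rot_less_total[OF assms] assms by (metis less_asym less_irrefl)
qed

lemma rank_bij: "bij_betw (rot_rank \<sigma> n w b) {..<n} {1..n}"
proof -
  let ?r = "rot_rank \<sigma> n w b"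
  have inj: "inj_on ?r {..<n}"
    by (rule inj_onI) (metis lessThan_iff less_irrefl rank_less_iff rot_less_total)
  have "?r i \<in> {1..n}" if "i < n" for i
  proof -
    have "card {j. j < n \<and> rot_less \<sigma> n w b j i} < card {..<n}"
      by (rule psubset_card_mono) (use that rot_less_irrefl in auto)
    then show ?thesis
      by (simp add: rot_rank_def)
  qed
  then have "?r ` {..<n} = {1..n}"
    by (intro card_subset_eq) (auto simp: card_image[OF inj])
  with inj show ?thesis
    by (simp add: bij_betw_def)
qed

lemma rank_in: "rot_rank \<sigma> n w b i \<in> {1..n}"
  using bij_betwE[OF rank_bij, rule_format, of "i mod n"] n_pos by (simp add: rank_mod)

text \<open>Rotations beginning with \<open>False\<close> precede all those beginning with
  \<open>True\<close> and so fill the lowest ranks. Their number is thus the split of the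
  reconstructed cycle.\<close>

lemma less_rank_iff: "card {i. i < n \<and> \<not> w i} < rot_rank \<sigma> n w b i \<longleftrightarrow> w i"
proof -
  define j where "j = i mod n"
  have j: "j < n"
    using n_pos by (simp add: j_def)
  have "card {i. i < n \<and> \<not> w i} < rot_rank \<sigma> n w b j \<longleftrightarrow> w j"
  proof (cases "w j")
    case True
    then have "card {i. i < n \<and> \<not> w i} \<le> card {i. i < n \<and> rot_less \<sigma> n w b i j}"
      using rot_less_letters by (intro card_mono) auto
    with True show ?thesis
      by (simp add: rot_rank_def)
  next
    case False
    have "card {i. i < n \<and> rot_less \<sigma> n w b i j} < card {i. i < n \<and> \<not> w i}"
      using rot_less_letters[of _ j] False j rot_less_irrefl by (intro psubset_card_mono) auto
    with False show ?thesis
      by (simp add: rot_rank_def)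
  qed
  then show ?thesis
    using period_n by (simp add: j_def rank_mod period_eq_mod)
qed

end

section \<open>Itineraries of cyclic permutations\<close>

text \<open>The letter \<open>False\<close> stands for the left side of the split and
  \<open>True\<close> for the right; \<open>\<sigma>\<close> tells which sides are decreasing. The
  codomain is general so that negated integer values can be used to exchange increasing and
  decreasing.\<close>

definition signed_mono :: "(bool \<Rightarrow> bool) \<Rightarrow> nat \<Rightarrow> nat \<Rightarrow> (nat \<Rightarrow> 'a :: linorder) \<Rightarrow> bool" where
  "signed_mono \<sigma> n k \<pi> \<longleftrightarrow> (\<forall>i\<in>{1..n}. \<forall>j\<in>{1..n}.
     i < j \<longrightarrow> (k < i) = (k < j) \<longrightarrow> (\<pi> i < \<pi> j) = (\<not> \<sigma> (k < i)))"

definition itin :: "(nat \<Rightarrow> nat) \<Rightarrow> nat \<Rightarrow> nat \<Rightarrow> nat \<Rightarrow> bool" where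
  "itin \<pi> k x = (\<lambda>i. k < (\<pi> ^^ i) x)"

locale split_cycle =
  fixes \<sigma> :: "bool \<Rightarrow> bool" and n k :: nat and \<pi> :: "nat \<Rightarrow> nat"
  assumes perm: "\<pi> permutes {1..n}" and cyclic: "cyclic_on \<pi> {1..n}"
    and k_le: "k \<le> n" and mono: "signed_mono \<sigma> n k \<pi>"
begin

lemma n_pos: "n > 0"
  using cyclic by (auto simp: cyclic_on_def)

lemma funpow_in: "x \<in> {1..n} \<Longrightarrow> (\<pi> ^^ i) x \<in> {1..n}"
  using cyclic by (rule cyclic_on_funpow_in)

lemma funpow_eq_iff: "(\<pi> ^^ i) x = (\<pi> ^^ i) y \<longleftrightarrow> x = y"
  using bij_fn[OF permutes_bij[OF perm], of i] by (auto simp: bij_def inj_def)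

lemma
  assumes x: "x \<in> {1..n}"
  shows funpow_bij: "bij_betw (\<lambda>i. (\<pi> ^^ i) x) {..<n} {1..n}"
    and funpow_fix_iff: "(\<pi> ^^ i) x = x \<longleftrightarrow> n dvd i"
proof -
  let ?D = "funpow_dist1 \<pi> x x"
  have orb: "orbit \<pi> x = {1..n}"
    using cyclic x by (rule orbit_cyclic_eq3)
  then have self: "x \<in> orbit \<pi> x"
    using x by simp
  have inj: "inj_on (\<lambda>i. (\<pi> ^^ i) x) {0..<?D}"
    using self by (rule inj_on_funpow_dist1)
  have img: "{1..n} = (\<lambda>i. (\<pi> ^^ i) x) ` {0..<?D}"
    using orbit_conv_funpow_dist1[OF self] orb by simp
  then have "n = ?D"
    using card_image[OF inj] by (metis card_atLeastAtMost card_atLeastLessThan diff_Suc_1 diff_zero)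
  with inj img have inj: "inj_on (\<lambda>i. (\<pi> ^^ i) x) {..<n}"
    and img: "(\<lambda>i. (\<pi> ^^ i) x) ` {..<n} = {1..n}"
    by (simp_all add: lessThan_atLeast0)
  then show "bij_betw (\<lambda>i. (\<pi> ^^ i) x) {..<n} {1..n}"
    by (simp add: bij_betw_def)
  have cycle_closes: "(\<pi> ^^ n) x = x"
    using funpow_dist1_prop[OF self] \<open>n = ?D\<close> by simp
  then have "(\<pi> ^^ i) x = (\<pi> ^^ (i mod n)) x"
    by (simp add: funpow_mod_eq)
  moreover have "(\<pi> ^^ (i mod n)) x = x \<longleftrightarrow> i mod n = 0"
    using inj_onD[OF inj, of "i mod n" 0] n_pos by auto
  ultimately show "(\<pi> ^^ i) x = x \<longleftrightarrow> n dvd i"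
    by (simp add: dvd_eq_mod_eq_0)
qed

lemma itin_funpow: "itin \<pi> k ((\<pi> ^^ i) x) = shift (itin \<pi> k x) i"
  by (simp add: itin_def shift_def funpow_add)

lemma itin_period: "x \<in> {1..n} \<Longrightarrow> period n (itin \<pi> k x)"
  using funpow_fix_iff[of x n] by (simp add: period_def itin_def funpow_add)

lemma less_step:
  assumes "a \<in> {1..n}" "c \<in> {1..n}" "a \<noteq> c" "(k < a) = (k < c)"
  shows "(\<pi> a < \<pi> c) = ((a < c) \<noteq> \<sigma> (k < a))"
proof -
  have "\<pi> a \<noteq> \<pi> c"
    using funpow_eq_iff[of 1] assms by simp
  then show ?thesis
    using mono[unfolded signed_mono_def, rule_format, of a c]
      mono[unfolded signed_mono_def, rule_format, of c a] assms
    by (cases a c rule: linorder_cases) auto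
qed

text \<open>While the itineraries agree, both points lie on the same side of the split, so each step
  keeps or reverses their order according to the common letter; \<open>par\<close> accumulates the
  reversals.\<close>

lemma less_funpow:
  assumes "x \<in> {1..n}" "y \<in> {1..n}" "x \<noteq> y" "\<And>i. i < j \<Longrightarrow> itin \<pi> k x i = itin \<pi> k y i"
  shows "((\<pi> ^^ j) x < (\<pi> ^^ j) y) = ((x < y) \<noteq> par \<sigma> (itin \<pi> k x) j)"
  using assms(4)
proof (induction j)
  case (Suc j)
  have "(\<pi> ((\<pi> ^^ j) x) < \<pi> ((\<pi> ^^ j) y)) =
      (((\<pi> ^^ j) x < (\<pi> ^^ j) y) \<noteq> \<sigma> (k < (\<pi> ^^ j) x))"
    using Suc.prems[of j] assms(3)
    by (intro less_step funpow_in assms(1,2)) (simp_all add: funpow_eq_iff itin_def)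
  then show ?case
    using Suc by (auto simp: itin_def)
qed simp

text \<open>At the first difference of the itineraries the split separates the two iterates, and
  \<open>less_funpow\<close> carries this comparison back to the starting points.\<close>

lemma less_iff_sless:
  assumes "x \<in> {1..n}" "y \<in> {1..n}" "itin \<pi> k x \<noteq> itin \<pi> k y"
  shows "x < y \<longleftrightarrow> sless \<sigma> (itin \<pi> k x) (itin \<pi> k y)"
proof -
  obtain j where j: "\<And>i. i < j \<Longrightarrow> itin \<pi> k x i = itin \<pi> k y i" "itin \<pi> k x j \<noteq> itin \<pi> k y j"
    using first_difference[OF assms(3)] by blast
  have "x \<noteq> y"
    using assms(3) by auto
  then have "((\<pi> ^^ j) x < (\<pi> ^^ j) y) = ((x < y) \<noteq> par \<sigma> (itin \<pi> k x) j)"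
    using assms j less_funpow by blast
  moreover have "((\<pi> ^^ j) x < (\<pi> ^^ j) y) = itin \<pi> k y j"
    using j(2) by (auto simp: itin_def)
  ultimately show ?thesis
    using sless_at[of j "itin \<pi> k x" "itin \<pi> k y" \<sigma>] j by auto
qed

text \<open>An order-preserving power of \<open>\<pi>\<close> would generate a strictly monotone infinite orbit.\<close>

lemma even_period_imp_fix:
  assumes x: "x \<in> {1..n}" and per: "period m (itin \<pi> k x)" and par: "\<not> par \<sigma> (itin \<pi> k x) m"
  shows "(\<pi> ^^ m) x = x"
proof (rule ccontr)
  define y where "y = (\<pi> ^^ m) x"
  define f where "f r = (\<pi> ^^ (r * m)) x" for r
  assume "(\<pi> ^^ m) x \<noteq> x"
  then have "y \<noteq> x" by (simp add: y_def)
  have y: "y \<in> {1..n}"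
    using funpow_in[OF x] by (simp add: y_def)
  have eq: "itin \<pi> k x = itin \<pi> k y"
    unfolding y_def itin_funpow using per by (simp add: shift_def period_def)
  have "(f r < f (Suc r)) = (x < y)" for r
  proof -
    have "((\<pi> ^^ (r * m)) x < (\<pi> ^^ (r * m)) y) = ((x < y) \<noteq> par \<sigma> (itin \<pi> k x) (r * m))"
      using x y \<open>y \<noteq> x\<close> eq by (intro less_funpow) auto
    moreover have "(\<pi> ^^ (r * m)) y = f (Suc r)"
      by (simp add: f_def y_def add.commute[of m] funpow_add)
    ultimately show ?thesis
      using par by (simp add: f_def par_mult_period[OF per])
  qed
  moreover have "f r \<noteq> f (Suc r)" for r
    using \<open>y \<noteq> x\<close> funpow_eq_iff[of "r * m" x y]
    by (auto simp: f_def y_def add.commute[of m] funpow_add)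
  \<comment> \<open>All steps of the orbit go in the same direction. Negating the values turns the
    decreasing case into an increasing one, so the same lemma contradicts the return
    \<open>f n = f 0\<close> in both.\<close>
  ultimately have "(\<forall>r. int (f r) < int (f (Suc r))) \<or> (\<forall>r. - int (f r) < - int (f (Suc r)))"
    by (metis linorder_neqE_nat neg_less_iff_less of_nat_less_iff)
  then have "f 0 \<noteq> f n"
    using lift_Suc_mono_less[of "\<lambda>r. int (f r)" 0 n] lift_Suc_mono_less[of "\<lambda>r. - int (f r)" 0 n] n_pos
    by auto
  moreover have "f n = f 0"
    using funpow_fix_iff[OF x, of "n * m"] by (simp add: f_def)
  ultimately show False by simp
qed

text \<open>By \<open>even_period_imp_fix\<close>, a period of even parity fixes \<open>x\<close>
  and is a multiple of \<open>n\<close>. Hence \<open>m\<close> has odd parity; the period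
  \<open>2 * m\<close> has even parity and fixes \<open>x\<close>.\<close>

lemma itin_period_imp:
  assumes x: "x \<in> {1..n}" and per: "period m (itin \<pi> k x)" and m: "\<not> n dvd m"
  shows "par \<sigma> (itin \<pi> k x) m" "n dvd 2 * m"
proof -
  show "par \<sigma> (itin \<pi> k x) m"
    using even_period_imp_fix[OF x per] funpow_fix_iff[OF x] m by blast
  have "(\<pi> ^^ (2 * m)) x = x"
    by (rule even_period_imp_fix[OF x period_mult[OF per]]) (simp add: par_mult_period[OF per])
  then show "n dvd 2 * m"
    using funpow_fix_iff[OF x] by blast
qed

text \<open>For an itinerary \<open>u u\<close>, \<open>x\<close> and the point half a turn later
  share their itinerary; the bit records which is smaller, in agreement with \<open>tiebreak\<close>
  at index 0. It is \<open>False\<close> for primitive itineraries, as \<open>codes\<close>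
  demands.\<close>

definition half_bit :: "nat \<Rightarrow> bool" where
  "half_bit x \<longleftrightarrow> \<not> primitive n (itin \<pi> k x) \<and> (\<pi> ^^ (n div 2)) x < x"

text \<open>A period \<open>m\<close> that is no multiple of \<open>n\<close> still satisfies
  \<open>n dvd 2 * m\<close>. So \<open>n = 2 * h\<close> and \<open>m\<close> is an odd multiple of
  \<open>h\<close>; removing multiples of \<open>n\<close> leaves the period \<open>h\<close>, which
  divides every other period for the same reason.\<close>

lemma itin_in_codes:
  assumes x: "x \<in> {1..n}"
  shows "(itin \<pi> k x, half_bit x) \<in> codes \<sigma> n"
proof (cases "primitive n (itin \<pi> k x)")
  case True
  then show ?thesis
    by (simp add: codes_def half_bit_def)
next
  case False
  let ?w = "itin \<pi> k x"
  have "period m ?w" if "n dvd m" for m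
    using that period_mult[OF itin_period[OF x]] by (auto simp: mult.commute[of n])
  then obtain m where m: "period m ?w" "\<not> n dvd m"
    using False n_pos unfolding primitive_def by blast
  then have n2m: "n dvd 2 * m"
    using itin_period_imp[OF x] by blast
  have "even n"
  proof (rule ccontr)
    assume "odd n"
    then have "coprime n 2"
      by simp
    with n2m m show False
      using coprime_dvd_mult_right_iff by blast
  qed
  then obtain h where h: "n = 2 * h"
    by auto
  then have "h dvd m" "h > 0"
    using n2m n_pos by auto
  then obtain c where c: "m = h * c"
    by auto
  then have "odd c"
    using m(2) h by auto
  then obtain e where "c = 2 * e + 1"
    by (elim oddE)
  then have "m = h + e * n"
    using c h by (simp add: algebra_simps)
  then have per: "period h ?w"
    using m(1) period_add_cancel[OF period_mult[OF itin_period[OF x], of e], of h] by simp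
  have "h dvd l" if "period l ?w" for l
    using itin_period_imp(2)[OF x that] h by (cases "n dvd l") auto
  then have "primitive h ?w"
    using \<open>h > 0\<close> period_mult[OF per] by (auto simp: primitive_def mult.commute[of h])
  moreover have "par \<sigma> ?w h"
    using itin_period_imp(1)[OF x per] h \<open>h > 0\<close> by (auto dest: dvd_imp_le)
  ultimately show ?thesis
    using \<open>even n\<close> h by (simp add: codes_def)
qed

text \<open>Points with different itineraries compare by \<open>sless\<close>. Equal itineraries
  occur only half a turn apart, where the comparison stored in \<open>half_bit\<close> is
  transported along \<open>i\<close> steps by \<open>less_funpow\<close>.\<close>

lemma point_less_iff:
  assumes x: "x \<in> {1..n}" and ij: "i < n" "j < n"
  shows "(\<pi> ^^ i) x < (\<pi> ^^ j) x \<longleftrightarrow> rot_less \<sigma> n (itin \<pi> k x) (half_bit x) i j"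
proof -
  let ?w = "itin \<pi> k x" and ?b = "half_bit x"
  interpret code \<sigma> n ?w ?b
    using itin_in_codes[OF x] by unfold_locales
  have main: "(\<pi> ^^ i) x < (\<pi> ^^ j) x \<longleftrightarrow> rot_less \<sigma> n ?w ?b i j" if "i < j" "j < n" for i j
  proof (cases "shift ?w i = shift ?w j")
    case False
    then show ?thesis
      using less_iff_sless[OF funpow_in[OF x] funpow_in[OF x], of i j]
      by (simp add: rot_less_def itin_funpow)
  next
    case True
    let ?y = "(\<pi> ^^ (n div 2)) x"
    note np = shift_eqD(1)[OF True that] and j = shift_eqD(2)[OF True that]
    have ne: "\<not> n dvd n div 2"
      using that j by (auto dest: dvd_imp_le)
    have per: "period (n div 2) ?w"
      using not_primitiveD(2)[OF np] by (rule primitive_period)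
    have "itin \<pi> k ?y = ?w"
      unfolding itin_funpow using per by (simp add: shift_def period_def)
    moreover have "?y \<noteq> x"
      using ne funpow_fix_iff[OF x] by blast
    ultimately have "((\<pi> ^^ i) x < (\<pi> ^^ i) ?y) = ((x < ?y) \<noteq> par \<sigma> ?w i)"
      by (intro less_funpow x funpow_in) auto
    also have "(\<pi> ^^ i) ?y = (\<pi> ^^ j) x"
      by (simp add: j funpow_add)
    also have "(x < ?y) = (\<not> ?b)"
      using np \<open>?y \<noteq> x\<close> by (auto simp: half_bit_def)
    finally show ?thesis
      using True tiebreak_half[OF np, of i] np by (auto simp: rot_less_def j tiebreak_def)
  qed
  have ne: "(\<pi> ^^ i) x \<noteq> (\<pi> ^^ j) x" if "i \<noteq> j"
    using bij_betw_imp_inj_on[OF funpow_bij[OF x]] ij that by (auto dest: inj_onD)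
  consider "i < j" | "i = j" | "j < i" by linarith
  then show ?thesis
  proof cases
    case 1
    then show ?thesis using main ij by blast
  next
    case 2
    then show ?thesis by (simp add: rot_less_irrefl)
  next
    case 3
    then show ?thesis
      using main[of j i] rot_less_total[OF ij] ne ij by auto
  qed
qed

text \<open>The orbit fills \<open>{1..n}\<close>, so the value of a point is one more than the
  number of smaller orbit points. The code fixes the order of the orbit and hence the values
  themselves.\<close>

lemma funpow_eq_rank:
  assumes x: "x \<in> {1..n}" and i: "i < n"
  shows "(\<pi> ^^ i) x = rot_rank \<sigma> n (itin \<pi> k x) (half_bit x) i"
proof -
  let ?p = "\<lambda>i. (\<pi> ^^ i) x"
  have inj: "inj_on ?p {..<n}" and img: "?p ` {..<n} = {1..n}"
    using funpow_bij[OF x] by (auto simp: bij_betw_def)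
  have pi: "?p i \<in> {1..n}"
    using funpow_in[OF x] .
  have "?p ` {j. j < n \<and> ?p j < ?p i} = {y \<in> {1..n}. y < ?p i}"
    unfolding img[symmetric] by auto
  also have "\<dots> = {1..<?p i}"
    using pi by auto
  finally have img': "?p ` {j. j < n \<and> ?p j < ?p i} = {1..<?p i}" .
  have "inj_on ?p {j. j < n \<and> ?p j < ?p i}"
    by (rule inj_on_subset[OF inj]) auto
  from card_image[OF this] have "card {j. j < n \<and> ?p j < ?p i} = ?p i - 1"
    unfolding img' by simp
  moreover have "{j. j < n \<and> ?p j < ?p i} =
      {j. j < n \<and> rot_less \<sigma> n (itin \<pi> k x) (half_bit x) j i}"
    using point_less_iff[OF x _ i] by blast
  ultimately show ?thesis
    using pi by (simp add: rot_rank_def)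
qed

lemma k_eq_card:
  assumes x: "x \<in> {1..n}"
  shows "k = card {i. i < n \<and> \<not> itin \<pi> k x i}"
proof -
  let ?p = "\<lambda>i. (\<pi> ^^ i) x"
  have inj: "inj_on ?p {..<n}" and img: "?p ` {..<n} = {1..n}"
    using funpow_bij[OF x] by (auto simp: bij_betw_def)
  have "?p ` {i. i < n \<and> \<not> itin \<pi> k x i} = {y \<in> {1..n}. y \<le> k}"
    unfolding img[symmetric] itin_def by auto
  also have "\<dots> = {1..k}"
    using k_le by auto
  finally have img': "?p ` {i. i < n \<and> \<not> itin \<pi> k x i} = {1..k}" .
  have "inj_on ?p {i. i < n \<and> \<not> itin \<pi> k x i}"
    by (rule inj_on_subset[OF inj]) auto
  from card_image[OF this] show ?thesis
    unfolding img' by simp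
qed

end

section \<open>The bijection between pointed split cycles and codes\<close>

definition split_cycles :: "(bool \<Rightarrow> bool) \<Rightarrow> nat \<Rightarrow> ((nat \<Rightarrow> nat) \<times> nat \<times> nat) set" where
  "split_cycles \<sigma> n = {(\<pi>, k, x). split_cycle \<sigma> n k \<pi> \<and> x \<in> {1..n}}"

definition encode :: "nat \<Rightarrow> (nat \<Rightarrow> nat) \<times> nat \<times> nat \<Rightarrow> (nat \<Rightarrow> bool) \<times> bool" where
  "encode n = (\<lambda>(\<pi>, k, x). (itin \<pi> k x, split_cycle.half_bit n k \<pi> x))"

text \<open>The code determines every iterate of \<open>x\<close> by \<open>funpow_eq_rank\<close>,
  hence \<open>\<pi>\<close> and \<open>x\<close>; the split is the number of \<open>False\<close>
  letters in one period.\<close>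

lemma inj_on_encode: "inj_on (encode n) (split_cycles \<sigma> n)"
proof (rule inj_onI, unfold split_paired_all)
  fix \<pi> k x \<pi>' k' x'
  assume "(\<pi>, k, x) \<in> split_cycles \<sigma> n" "(\<pi>', k', x') \<in> split_cycles \<sigma> n"
    and enc: "encode n (\<pi>, k, x) = encode n (\<pi>', k', x')"
  then have x: "x \<in> {1..n}" "x' \<in> {1..n}" and "split_cycle \<sigma> n k \<pi>" "split_cycle \<sigma> n k' \<pi>'"
    by (auto simp: split_cycles_def)
  then interpret A: split_cycle \<sigma> n k \<pi> + B: split_cycle \<sigma> n k' \<pi>'
    by auto
  have w: "itin \<pi> k x = itin \<pi>' k' x'" and b: "A.half_bit x = B.half_bit x'"
    using enc by (auto simp: encode_def)
  have eq: "(\<pi> ^^ i) x = (\<pi>' ^^ i) x'" if "i < n" for i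
    using A.funpow_eq_rank[OF x(1) that] B.funpow_eq_rank[OF x(2) that] w b by simp
  have eq: "(\<pi> ^^ i) x = (\<pi>' ^^ i) x'" for i
    using eq[of "i mod n"] A.n_pos A.funpow_fix_iff[OF x(1), of n] B.funpow_fix_iff[OF x(2), of n]
    by (simp add: funpow_mod_eq)
  have "\<pi> y = \<pi>' y" for y
  proof (cases "y \<in> {1..n}")
    case True
    then obtain i where "y = (\<pi> ^^ i) x"
      using bij_betw_imp_surj_on[OF A.funpow_bij[OF x(1)]] by blast
    then show ?thesis
      using eq[of i] eq[of "Suc i"] by simp
  next
    case False
    then show ?thesis
      using A.perm B.perm by (metis permutes_not_in)
  qed
  moreover have "x = x'"
    using eq[of 0] by simp
  moreover have "k = k'"
    using A.k_eq_card[OF x(1)] B.k_eq_card[OF x(2)] w by simp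
  ultimately show "(\<pi>, k, x) = (\<pi>', k', x')"
    by auto
qed

text \<open>The cycle is rebuilt by sending the rank of rotation \<open>i\<close> to the rank of
  rotation \<open>Suc i\<close>, with the rank of rotation 0 as base point. The split comes from
  \<open>less_rank_iff\<close>, and monotonicity from \<open>rot_less_Suc\<close>.\<close>

lemma (in code) code_in_image: "(w, b) \<in> encode n ` split_cycles \<sigma> n"
proof -
  let ?r = "rot_rank \<sigma> n w b"
  define k where "k = card {i. i < n \<and> \<not> w i}"
  define \<pi> where "\<pi> y = (if y \<in> {1..n} then ?r (Suc (inv_into {..<n} ?r y)) else y)" for y
  have inj: "inj_on ?r {..<n}" and img: "?r ` {..<n} = {1..n}"
    using rank_bij by (auto simp: bij_betw_def)
  have \<pi>_rank: "\<pi> (?r i) = ?r (Suc i)" for i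
  proof -
    have "\<pi> (?r (i mod n)) = ?r (Suc (i mod n))"
      using inv_into_f_f[OF inj, of "i mod n"] n_pos rank_in[of "i mod n"] by (simp add: \<pi>_def)
    then show ?thesis
      by (metis mod_Suc_eq rank_mod)
  qed
  have funpow: "(\<pi> ^^ i) (?r 0) = ?r i" for i
    by (induction i) (simp_all add: \<pi>_rank)
  have "{1..n} \<subseteq> \<pi> ` {1..n}"
  proof
    fix y assume "y \<in> {1..n}"
    then obtain j where "y = ?r j"
      using img by blast
    \<comment> \<open>The index \<open>j + n - 1\<close> is the cyclic predecessor of
      \<open>j\<close>, also for \<open>j = 0\<close>.\<close>
    also have "\<dots> = \<pi> (?r (j + n - 1))"
      using \<pi>_rank[of "j + n - 1"] n_pos by (simp add: rank_add_n)
    finally show "y \<in> \<pi> ` {1..n}"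
      using rank_in by blast
  qed
  moreover have "\<pi> ` {1..n} \<subseteq> {1..n}"
    using rank_in by (auto simp: \<pi>_def simp del: atLeastAtMost_iff)
  ultimately have img\<pi>: "\<pi> ` {1..n} = {1..n}"
    by blast
  then have "inj_on \<pi> {1..n}"
    by (intro eq_card_imp_inj_on) simp_all
  with img\<pi> have perm: "\<pi> permutes {1..n}"
    by (intro bij_imp_permutes) (auto simp: bij_betw_def \<pi>_def)
  have "y \<in> orbit \<pi> (?r 0)" if y: "y \<in> {1..n}" for y
  proof -
    obtain j where "y = ?r j"
      using img y by blast
    \<comment> \<open>An orbit consists of positive iterates, so a full turn is added to cover
      \<open>j = 0\<close>.\<close>
    then have "y = (\<pi> ^^ (j + n)) (?r 0)"
      by (simp only: funpow rank_add_n)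
    then show ?thesis
      using n_pos by (auto simp: orbit_altdef)
  qed
  moreover have "orbit \<pi> (?r 0) \<subseteq> {1..n}"
    using perm rank_in by (rule permutes_orbit_subset)
  ultimately have cyclic: "cyclic_on \<pi> {1..n}"
    using rank_in[of 0] by (intro cyclic_on_singleI[of "?r 0"]) auto
  have "card {i. i < n \<and> \<not> w i} \<le> card {..<n}"
    by (rule card_mono) auto
  then have k: "k \<le> n"
    by (simp add: k_def)
  have side: "k < ?r i \<longleftrightarrow> w i" for i
    unfolding k_def by (rule less_rank_iff)
  have mono: "signed_mono \<sigma> n k \<pi>"
    unfolding signed_mono_def
  proof (intro ballI impI)
    fix a c assume "a \<in> {1..n}" "c \<in> {1..n}" and less: "a < c" and eq: "(k < a) = (k < c)"
    then obtain i j where i: "a = ?r i" "i < n" and j: "c = ?r j" "j < n"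
      using img by (metis image_iff lessThan_iff)
    have less': "rot_less \<sigma> n w b i j"
      using less rank_less_iff i j by simp
    have w: "w i = w j"
      using eq side i j by simp
    have "i \<noteq> j"
      using less i j by auto
    have "Suc i mod n \<noteq> Suc j mod n"
    proof
      assume "Suc i mod n = Suc j mod n"
      then have "?r (Suc i) = ?r (Suc j)"
        by (metis rank_mod)
      then have "\<pi> a = \<pi> c"
        using i j by (simp add: \<pi>_rank)
      with \<open>inj_on \<pi> {1..n}\<close> \<open>a \<in> {1..n}\<close> \<open>c \<in> {1..n}\<close> less show False
        by (auto dest: inj_onD)
    qed
    have "\<pi> a < \<pi> c \<longleftrightarrow> ?r (Suc i mod n) < ?r (Suc j mod n)"
      using i j by (simp add: \<pi>_rank rank_mod)
    also have "\<dots> \<longleftrightarrow> rot_less \<sigma> n w b (Suc i mod n) (Suc j mod n)"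
      by (rule rank_less_iff) (use n_pos in auto)
    also have "\<dots> \<longleftrightarrow> rot_less \<sigma> n w b (Suc i) (Suc j)"
      by (rule rot_less_mod)
    also have "\<dots> \<longleftrightarrow> \<not> \<sigma> (w i)"
      using rot_less_Suc[OF w] i j \<open>i \<noteq> j\<close> less' by simp
    finally show "\<pi> a < \<pi> c \<longleftrightarrow> \<not> \<sigma> (k < a)"
      using side i by simp
  qed
  interpret S: split_cycle \<sigma> n k \<pi>
    by unfold_locales (fact perm cyclic k mono)+
  have itin: "itin \<pi> k (?r 0) = w"
    by (simp add: itin_def funpow side)
  have "S.half_bit (?r 0) = b"
  proof (cases "primitive n w")
    case True
    have "n div 2 \<noteq> n"
      using n_pos by linarith
    then have "\<not> primitive (n div 2) w"
      using primitive_unique[OF True] by metis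
    then have "\<not> b"
      using code by (simp add: codes_def)
    with True show ?thesis
      unfolding S.half_bit_def itin by simp
  next
    case False
    note D = not_primitiveD[OF False]
    \<comment> \<open>The two rotations coincide, so only the tiebreak compares them: it is
      \<open>b\<close> at index 0 and the opposite at \<open>n div 2\<close>.\<close>
    have "shift w (n div 2) = shift w 0"
      using primitive_period[OF D(2)] by (simp add: shift_def period_def)
    then have "rot_less \<sigma> n w b (n div 2) 0 = b"
      using False D(3) by (simp add: rot_less_def tiebreak_def)
    then show ?thesis
      using False rank_less_iff[of "n div 2" 0] n_pos
      unfolding S.half_bit_def itin funpow by simp
  qed
  then have "encode n (\<pi>, k, ?r 0) = (w, b)"
    by (simp add: encode_def itin)
  moreover have "(\<pi>, k, ?r 0) \<in> split_cycles \<sigma> n"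
    using S.split_cycle_axioms rank_in by (simp add: split_cycles_def del: atLeastAtMost_iff)
  ultimately show ?thesis
    by (metis image_eqI)
qed

lemma bij_betw_encode: "bij_betw (encode n) (split_cycles \<sigma> n) (codes \<sigma> n)"
proof -
  have "encode n ` split_cycles \<sigma> n \<subseteq> codes \<sigma> n"
    by (auto simp: split_cycles_def encode_def split_cycle.itin_in_codes simp del: atLeastAtMost_iff)
  moreover have "codes \<sigma> n \<subseteq> encode n ` split_cycles \<sigma> n"
    using code.code_in_image[OF code.intro] by (intro subrelI)
  ultimately show ?thesis
    using inj_on_encode by (auto simp: bij_betw_def)
qed

section \<open>Counting split cycles\<close>

lemma card_primitive_Pair_False:
  "finite {(w, b). primitive n w \<and> P w \<and> \<not> b}"
  "card {(w, b). primitive n w \<and> P w \<and> \<not> b} = card {w. primitive n w \<and> P w}"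
proof -
  have eq: "{(w, b). primitive n w \<and> P w \<and> \<not> b} = {w. primitive n w \<and> P w} \<times> {False}"
    by auto
  show "finite {(w, b). primitive n w \<and> P w \<and> \<not> b}"
    "card {(w, b). primitive n w \<and> P w \<and> \<not> b} = card {w. primitive n w \<and> P w}"
    unfolding eq by (simp_all add: finite_primitive card_cartesian_product)
qed

lemma primitive_half_exclusive:
  assumes "n > 0" "primitive (n div 2) w"
  shows "\<not> primitive n w"
proof
  assume "primitive n w"
  then have "n div 2 = n"
    using assms(2) primitive_unique by blast
  with assms(1) show False
    by linarith
qed

lemma card_codes:
  assumes "n > 0"
  shows "card (codes \<sigma> n) = card {w. primitive n w} +
    (if even n then 2 * card {w. primitive (n div 2) w \<and> par \<sigma> w (n div 2)} else 0)"
proof -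
  let ?A = "{(w, b). primitive n w \<and> True \<and> \<not> b}"
  let ?H = "{w. primitive (n div 2) w \<and> par \<sigma> w (n div 2)}"
  let ?B = "(if even n then ?H else {}) \<times> (UNIV :: bool set)"
  have "codes \<sigma> n = ?A \<union> ?B"
    by (auto simp: codes_def)
  also have "card \<dots> = card ?A + card ?B"
    using primitive_half_exclusive[OF assms] card_primitive_Pair_False(1)[of n "\<lambda>_. True"]
    by (intro card_Un_disjoint) (auto simp: finite_primitive)
  finally show ?thesis
    using card_primitive_Pair_False(2)[of n "\<lambda>_. True"] by (simp add: card_cartesian_product)
qed

text \<open>A word \<open>u u\<close> has even parity over its full length, so odd parity leaves
  only primitive words, each with one code.\<close>

lemma codes_odd:
  assumes "n > 0"
  shows "{c \<in> codes \<sigma> n. par \<sigma> (fst c) n} = {(w, b). primitive n w \<and> par \<sigma> w n \<and> \<not> b}"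
proof -
  have *: "primitive n w \<and> \<not> b" if "(w, b) \<in> codes \<sigma> n" "par \<sigma> w n" for w b
  proof -
    interpret code \<sigma> n w b
      using that(1) by unfold_locales
    have "primitive n w"
      using not_primitiveD(4) that(2) by blast
    with that(1) primitive_half_exclusive[OF assms] show ?thesis
      by (auto simp: codes_def)
  qed
  moreover have "(w, False) \<in> codes \<sigma> n" if "primitive n w" for w
    using that by (simp add: codes_def)
  ultimately show ?thesis
    by (auto dest: *)
qed

lemma card_triples:
  assumes "\<And>\<pi>. \<pi> \<in> C \<Longrightarrow> \<exists>!k. R \<pi> k"
  shows "card {(\<pi>, k, x). \<pi> \<in> C \<and> R \<pi> k \<and> x \<in> X} = card C * card X"
proof -
  have "bij_betw (\<lambda>(\<pi>, k, x). (\<pi>, x)) {(\<pi>, k, x). \<pi> \<in> C \<and> R \<pi> k \<and> x \<in> X} (C \<times> X)"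
    using assms by (fastforce simp: bij_betw_def inj_on_def image_def)
  then show ?thesis
    by (simp add: bij_betw_same_card card_cartesian_product)
qed

definition mono_cycles :: "(bool \<Rightarrow> bool) \<Rightarrow> nat \<Rightarrow> (nat \<Rightarrow> nat) set" where
  "mono_cycles \<sigma> n = {\<pi>. \<pi> permutes {1..n} \<and> cyclic_on \<pi> {1..n} \<and> (\<exists>k\<le>n. signed_mono \<sigma> n k \<pi>)}"

lemma split_cycle_iff:
  "split_cycle \<sigma> n k \<pi> \<longleftrightarrow> \<pi> \<in> mono_cycles \<sigma> n \<and> k \<le> n \<and> signed_mono \<sigma> n k \<pi>"
  by (auto simp: split_cycle_def mono_cycles_def)

text \<open>When the split is unique, the base point is the only remaining freedom, and each cycle
  belongs to exactly \<open>n\<close> triples.\<close>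

lemma card_mono_cycles_unique_split:
  assumes "\<And>\<pi>. \<pi> \<in> mono_cycles \<sigma> n \<Longrightarrow> \<exists>!k. k \<le> n \<and> signed_mono \<sigma> n k \<pi>"
  shows "card (mono_cycles \<sigma> n) * n = card (codes \<sigma> n)"
proof -
  have "split_cycles \<sigma> n =
      {(\<pi>, k, x). \<pi> \<in> mono_cycles \<sigma> n \<and> (k \<le> n \<and> signed_mono \<sigma> n k \<pi>) \<and> x \<in> {1..n}}"
    by (auto simp: split_cycles_def split_cycle_iff)
  with card_triples[where R = "\<lambda>\<pi> k. k \<le> n \<and> signed_mono \<sigma> n k \<pi>", OF assms, of _ "{1..n}"]
  have "card (split_cycles \<sigma> n) = card (mono_cycles \<sigma> n) * n"
    by simp
  then show ?thesis
    using bij_betw_same_card[OF bij_betw_encode] by metis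
qed

text \<open>When a cycle has several splits, the parity of the itinerary selects one of them. The
  bijection \<open>encode\<close> restricts to the triples of odd parity, and
  \<open>codes_odd\<close> identifies their codes.\<close>

lemma card_mono_cycles_unique_odd_split:
  assumes n: "n > 0"
    and par: "\<And>\<pi> k x. split_cycle \<sigma> n k \<pi> \<Longrightarrow> x \<in> {1..n} \<Longrightarrow> par \<sigma> (itin \<pi> k x) n = Q k"
    and uniq: "\<And>\<pi>. \<pi> \<in> mono_cycles \<sigma> n \<Longrightarrow> \<exists>!k. (k \<le> n \<and> signed_mono \<sigma> n k \<pi>) \<and> Q k"
  shows "card (mono_cycles \<sigma> n) * n = card {w. primitive n w \<and> par \<sigma> w n}"
proof -
  let ?T = "{t \<in> split_cycles \<sigma> n. par \<sigma> (fst (encode n t)) n}"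
  have "?T = {(\<pi>, k, x). \<pi> \<in> mono_cycles \<sigma> n \<and> ((k \<le> n \<and> signed_mono \<sigma> n k \<pi>) \<and> Q k) \<and> x \<in> {1..n}}"
    using par by (auto simp: split_cycles_def split_cycle_iff encode_def)
  with card_triples[where R = "\<lambda>\<pi> k. (k \<le> n \<and> signed_mono \<sigma> n k \<pi>) \<and> Q k", OF uniq, of _ "{1..n}"]
  have "card (mono_cycles \<sigma> n) * n = card ?T"
    by simp
  also have "bij_betw (encode n) ?T {c \<in> codes \<sigma> n. par \<sigma> (fst c) n}"
  proof -
    have "encode n ` ?T = {c \<in> encode n ` split_cycles \<sigma> n. par \<sigma> (fst c) n}"
      by blast
    then show ?thesis
      using bij_betw_encode[of n \<sigma>] by (auto simp: bij_betw_def intro: inj_on_subset)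
  qed
  then have "card ?T = card {w. primitive n w \<and> par \<sigma> w n}"
    using card_primitive_Pair_False(2) by (simp add: bij_betw_same_card codes_odd[OF n])
  finally show ?thesis .
qed

lemma (in split_cycle) card_itin:
  assumes "x \<in> {1..n}"
  shows "card {i. i < n \<and> itin \<pi> k x i} = n - k"
proof -
  have "{i. i < n \<and> itin \<pi> k x i} = {..<n} - {i. i < n \<and> \<not> itin \<pi> k x i}"
    by auto
  also have "card \<dots> = n - k"
    using k_eq_card[OF assms] by (subst card_Diff_subset) auto
  finally show ?thesis .
qed

section \<open>Splitting positions\<close>

lemma signed_mono_uminus:
  assumes "inj_on f {1..n}"
  shows "signed_mono \<sigma> n k (\<lambda>i. - int (f i)) = signed_mono (\<lambda>c. \<not> \<sigma> c) n k f"
proof -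
  have "f j < f i \<longleftrightarrow> \<not> f i < f j" if "i \<in> {1..n}" "j \<in> {1..n}" "i < j" for i j
    using inj_onD[OF assms, of i j] that by (cases "f i" "f j" rule: linorder_cases) auto
  then show ?thesis
    unfolding signed_mono_def by auto
qed

lemma inj_on_uminus_int: "inj_on f A \<Longrightarrow> inj_on (\<lambda>i. - int (f i)) A"
  by (rule inj_onI) (auto dest: inj_onD)

definition valley :: "nat \<Rightarrow> (nat \<Rightarrow> 'a :: linorder) \<Rightarrow> bool" where
  "valley n f \<longleftrightarrow> (\<exists>i j l. 1 \<le> i \<and> i < j \<and> j < l \<and> l \<le> n \<and> f j < f i \<and> f j < f l)"

text \<open>The obstruction to cutting a sequence into two increasing pieces: the position intervals
  of the two inversions share at most an endpoint, so any cut leaves one inversion entirely on one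
  side.\<close>

definition two_inversions :: "nat \<Rightarrow> (nat \<Rightarrow> 'a :: linorder) \<Rightarrow> bool" where
  "two_inversions n f \<longleftrightarrow> (\<exists>i j i' j'. 1 \<le> i \<and> i < j \<and> j \<le> i' \<and> i' < j' \<and> j' \<le> n \<and>
     f j < f i \<and> f j' < f i')"

lemma signed_monoD:
  assumes "signed_mono \<sigma> n k f" "1 \<le> i" "i < j" "j \<le> n" "(k < i) = (k < j)"
  shows "f i < f j \<longleftrightarrow> \<not> \<sigma> (k < i)"
  using assms unfolding signed_mono_def by simp

lemma signed_mono_imp_no_valley:
  assumes "signed_mono (\<lambda>c. c) n k f"
  shows "\<not> valley n f"
proof
  assume "valley n f"
  then obtain i j l where *: "1 \<le> i" "i < j" "j < l" "l \<le> n" "f j < f i" "f j < f l"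
    unfolding valley_def by blast
  show False
    using signed_monoD[OF assms, of i j] signed_monoD[OF assms, of j l] *
    by (cases "k < j") auto
qed

text \<open>Without valleys the values rise to the maximum at \<open>p\<close> and then fall. The
  peak itself may belong to either side, which gives exactly the splits \<open>p\<close> and
  \<open>p - 1\<close>.\<close>

lemma no_valley_splits:
  assumes n: "n \<ge> 1" and inj: "inj_on f {1..n}" and nv: "\<not> valley n f"
  shows "\<exists>p\<in>{1..n}. \<forall>k. k \<le> n \<and> signed_mono (\<lambda>c. c) n k f \<longleftrightarrow> k = p \<or> k = p - 1"
proof -
  have "Max (f ` {1..n}) \<in> f ` {1..n}"
    using n by (intro Max_in) auto
  then obtain p where p: "1 \<le> p" "p \<le> n" and max: "f p = Max (f ` {1..n})"
    by auto
  have ne: "f i < f j \<or> f j < f i" if "1 \<le> i" "i < j" "j \<le> n" for i j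
    using inj_onD[OF inj, of i j] that by (cases "f i" "f j" rule: linorder_cases) auto
  have le: "f i \<le> f p" if "1 \<le> i" "i \<le> n" for i
    unfolding max using that by (intro Max_ge) auto
  have less: "f i < f p" if "1 \<le> i" "i \<le> n" "i \<noteq> p" for i
    using le[of i] ne[of i p] ne[of p i] that p by (cases i p rule: linorder_cases) auto
  have no: False if "1 \<le> i" "i < j" "j < l" "l \<le> n" "f j < f i" "f j < f l" for i j l
    using nv that unfolding valley_def by blast
  \<comment> \<open>Otherwise \<open>i\<close>, \<open>j\<close> and the peak \<open>p\<close> would
    form a valley; \<open>decr\<close> uses the peak as the left rim in the same way.\<close>
  have incr: "f i < f j" if "1 \<le> i" "i < j" "j \<le> p" for i j
    using no[of i j p] ne[of i j] less[of i] less[of j] that p by (cases "j = p") auto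
  have decr: "f j < f i" if "p \<le> i" "i < j" "j \<le> n" for i j
    using no[of p i j] ne[of i j] less[of i] less[of j] that p by (cases "i = p") auto
  have "signed_mono (\<lambda>c. c) n k f" if k: "k = p \<or> k = p - 1" for k
    unfolding signed_mono_def
  proof (intro ballI impI)
    fix i j assume ij: "i \<in> {1..n}" "j \<in> {1..n}" "i < j" "(k < i) = (k < j)"
    show "f i < f j \<longleftrightarrow> \<not> k < i"
    proof (cases "k < i")
      case True
      then have "f j < f i"
        using k ij by (intro decr) auto
      with True show ?thesis by simp
    next
      case False
      then have "f i < f j"
        using k ij by (intro incr) auto
      with False show ?thesis by simp
    qed
  qed
  moreover have "k = p \<or> k = p - 1" if k: "k \<le> n" "signed_mono (\<lambda>c. c) n k f" for k
  proof (rule ccontr)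
    assume "\<not> (k = p \<or> k = p - 1)"
    then consider "p < k" | "k + 1 < p" by linarith
    then show False
    proof cases
      case 1
      then show False
        using signed_monoD[OF k(2), of p k] decr[of p k] p k by auto
    next
      case 2
      then show False
        using signed_monoD[OF k(2), of "k + 1" p] incr[of "k + 1" p] p k by auto
    qed
  qed
  ultimately show ?thesis
    using p by (intro bexI[of _ p]) auto
qed

lemma no_two_inversions_iff:
  assumes "inj_on f {1..n}"
  shows "\<not> two_inversions n f \<longleftrightarrow> (\<exists>k\<le>n. signed_mono (\<lambda>_. False) n k f)"
proof
  assume "\<exists>k\<le>n. signed_mono (\<lambda>_. False) n k f"
  then obtain k where k: "signed_mono (\<lambda>_. False) n k f"
    by blast
  show "\<not> two_inversions n f"
  proof
    assume "two_inversions n f"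
    then obtain i j i' j' where *: "1 \<le> i" "i < j" "j \<le> i'" "i' < j'" "j' \<le> n" "f j < f i" "f j' < f i'"
      unfolding two_inversions_def by blast
    show False
      using signed_monoD[OF k, of i j] signed_monoD[OF k, of i' j'] * by (cases "k < j") auto
  qed
next
  assume no: "\<not> two_inversions n f"
  \<comment> \<open>\<open>I\<close> collects the left ends of inversions. The cut is placed at the
    last of them, or at 0 if there is none, so that no inversion starts to its right.\<close>
  define I where "I = {i. \<exists>j. 1 \<le> i \<and> i < j \<and> j \<le> n \<and> f j < f i}"
  define k where "k = Max (insert 0 I)"
  have "I \<subseteq> {1..n}"
    by (auto simp: I_def)
  then have fin: "finite (insert 0 I)"
    using finite_subset by auto
  then have k_in: "k = 0 \<or> k \<in> I"
    using Max_in[of "insert 0 I"] by (auto simp: k_def)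
  then have "k \<le> n"
    using \<open>I \<subseteq> {1..n}\<close> by auto
  have straddle: "i \<le> k \<and> k < j" if "1 \<le> i" "i < j" "j \<le> n" "f j < f i" for i j
  proof
    have "i \<in> I"
      using that by (auto simp: I_def)
    then show "i \<le> k"
      using fin by (auto simp: k_def intro: Max_ge)
    \<comment> \<open>An inversion ending at or before \<open>k\<close>, followed by the one
      starting at \<open>k\<close>, would give two forbidden inversions.\<close>
    show "k < j"
    proof (rule ccontr)
      assume "\<not> k < j"
      with k_in that obtain j' where "k < j'" "j' \<le> n" "f j' < f k" "j \<le> k"
        by (auto simp: I_def)
      with no that show False
        unfolding two_inversions_def by blast
    qed
  qed
  have "signed_mono (\<lambda>_. False) n k f"
    unfolding signed_mono_def
  proof (intro ballI impI)
    fix i j assume ij: "i \<in> {1..n}" "j \<in> {1..n}" "i < j" "(k < i) = (k < j)"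
    then have "f i \<noteq> f j" "\<not> f j < f i"
      using inj_onD[OF assms, of i j] straddle[of i j] by auto
    then show "(f i < f j) = (\<not> False)"
      by auto
  qed
  with \<open>k \<le> n\<close> show "\<exists>k\<le>n. signed_mono (\<lambda>_. False) n k f"
    by blast
qed

text \<open>Position \<open>k + 1\<close> lies to the right of the smaller cut and to the left of
  the larger one. It therefore links the positions up to \<open>k\<close> with those beyond
  \<open>k'\<close>, and transitivity does the rest.\<close>

lemma two_splits_imp_mono:
  assumes k: "signed_mono (\<lambda>_. c) n k f" and k': "signed_mono (\<lambda>_. c) n k' f"
    and less: "k < k'" "k' \<le> n" and inj: "inj_on f {1..n}"
  shows "signed_mono (\<lambda>_. c) n n f"
  unfolding signed_mono_def
proof (intro ballI impI)
  fix i j assume ij: "i \<in> {1..n}" "j \<in> {1..n}" "i < j"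
  have ne: "f a \<noteq> f b" if "1 \<le> a" "a < b" "b \<le> n" for a b
    using inj_onD[OF inj, of a b] that by auto
  consider "j \<le> k'" | "k < i" | "i \<le> k" "k' < j" by linarith
  then show "(f i < f j) = (\<not> c)"
  proof cases
    case 1
    then show ?thesis using signed_monoD[OF k', of i j] ij by auto
  next
    case 2
    then show ?thesis using signed_monoD[OF k, of i j] ij by auto
  next
    case 3
    then have "f i < f (k + 1) \<longleftrightarrow> \<not> c" "f (k + 1) < f j \<longleftrightarrow> \<not> c"
      using signed_monoD[OF k', of i "k + 1"] signed_monoD[OF k, of "k + 1" j] ij less by auto
    moreover have "f i \<noteq> f (k + 1)" "f (k + 1) \<noteq> f j"
      using 3 ij less ne[of i "k + 1"] ne[of "k + 1" j] by auto
    ultimately show ?thesis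
      by (metis less_trans not_less_iff_gr_or_eq)
  qed
qed

text \<open>A monotone cycle has the constant itinerary, whose period \<open>1\<close> is only possible for tiny \<open>n\<close>.\<close>

lemma mono_cycle_small:
  assumes "split_cycle (\<lambda>_. c) n n \<pi>"
  shows "n = 1 \<or> n = 2 \<and> c"
proof (cases "n = 1")
  case False
  interpret split_cycle "\<lambda>_. c" n n \<pi>
    by fact
  have x: "1 \<in> {1..n}"
    using n_pos by simp
  have "itin \<pi> n 1 = (\<lambda>_. False)"
    using funpow_in[OF x] by (simp add: itin_def fun_eq_iff not_less)
  then have per: "period 1 (itin \<pi> n 1)"
    by (simp add: period_def)
  have "par (\<lambda>_. c) (itin \<pi> n 1) 1" "n dvd 2 * 1"
    using itin_period_imp[OF x per] False by auto
  then have "c" "n \<le> 2"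
    by (auto dest: dvd_imp_le)
  then show ?thesis
    using False n_pos by auto
qed simp

text \<open>Two different splits would make \<open>\<pi>\<close> monotone throughout, which
  \<open>mono_cycle_small\<close> rules out. The exceptions are genuine: the identity for
  \<open>n = 1\<close> and, with \<open>c\<close> true, the transposition for \<open>n = 2\<close>
  admit every split.\<close>

lemma unique_split_const:
  assumes "\<pi> \<in> mono_cycles (\<lambda>_. c) n" "n \<noteq> 1" "\<not> (n = 2 \<and> c)"
  shows "\<exists>!k. k \<le> n \<and> signed_mono (\<lambda>_. c) n k \<pi>"
proof -
  have perm: "\<pi> permutes {1..n}" and cyc: "cyclic_on \<pi> {1..n}"
    and ex: "\<exists>k\<le>n. signed_mono (\<lambda>_. c) n k \<pi>"
    using assms(1) by (auto simp: mono_cycles_def)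
  have "\<not> signed_mono (\<lambda>_. c) n n \<pi>"
    using mono_cycle_small[OF split_cycle.intro[OF perm cyc le_refl]] assms by blast
  then have "k = k'" if "k \<le> n" "k' \<le> n" "signed_mono (\<lambda>_. c) n k \<pi>" "signed_mono (\<lambda>_. c) n k' \<pi>" for k k'
    using two_splits_imp_mono[of c n k \<pi> k'] two_splits_imp_mono[of c n k' \<pi> k] that
      permutes_inj_on[OF perm] by (metis linorder_neqE_nat)
  with ex show ?thesis
    by blast
qed

section \<open>Pattern avoidance\<close>

lemma contains_pattern_3:
  "contains_pattern n \<tau> [a, b, c] \<longleftrightarrow> (\<exists>i j l. 1 \<le> i \<and> i < j \<and> j < l \<and> l \<le> n \<and>
     (\<tau> i < \<tau> j \<longleftrightarrow> a < b) \<and> (\<tau> j < \<tau> i \<longleftrightarrow> b < a) \<and> (\<tau> i < \<tau> l \<longleftrightarrow> a < c) \<and>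
     (\<tau> l < \<tau> i \<longleftrightarrow> c < a) \<and> (\<tau> j < \<tau> l \<longleftrightarrow> b < c) \<and> (\<tau> l < \<tau> j \<longleftrightarrow> c < b))" (is "?L \<longleftrightarrow> ?R")
proof
  assume ?L
  then obtain xs where xs: "length xs = 3" "sorted_wrt (<) xs" "set xs \<subseteq> {1..n}"
    "\<forall>j<3. \<forall>k<3. \<tau> (xs ! j) < \<tau> (xs ! k) \<longleftrightarrow> [a, b, c] ! j < [a, b, c] ! k"
    by (auto simp: contains_pattern_def numeral_3_eq_3)
  then obtain i j l where "xs = [i, j, l]"
    by (auto simp: numeral_3_eq_3 length_Suc_conv)
  with xs show ?R
    by (intro exI[of _ i] exI[of _ j] exI[of _ l]) (simp add: numeral_3_eq_3 All_less_Suc)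
next
  assume ?R
  then show ?L
    unfolding contains_pattern_def
    apply (elim exE)
    subgoal for i j l by (intro exI[of _ "[i, j, l]"]) (simp add: All_less_Suc)
    done
qed

lemma contains_pattern_4:
  "contains_pattern n \<tau> [a, b, c, d] \<longleftrightarrow> (\<exists>i j l m. 1 \<le> i \<and> i < j \<and> j < l \<and> l < m \<and> m \<le> n \<and>
     (\<tau> i < \<tau> j \<longleftrightarrow> a < b) \<and> (\<tau> j < \<tau> i \<longleftrightarrow> b < a) \<and> (\<tau> i < \<tau> l \<longleftrightarrow> a < c) \<and>
     (\<tau> l < \<tau> i \<longleftrightarrow> c < a) \<and> (\<tau> j < \<tau> l \<longleftrightarrow> b < c) \<and> (\<tau> l < \<tau> j \<longleftrightarrow> c < b) \<and>
     (\<tau> i < \<tau> m \<longleftrightarrow> a < d) \<and> (\<tau> m < \<tau> i \<longleftrightarrow> d < a) \<and> (\<tau> j < \<tau> m \<longleftrightarrow> b < d) \<and>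
     (\<tau> m < \<tau> j \<longleftrightarrow> d < b) \<and> (\<tau> l < \<tau> m \<longleftrightarrow> c < d) \<and> (\<tau> m < \<tau> l \<longleftrightarrow> d < c))" (is "?L \<longleftrightarrow> ?R")
proof
  assume ?L
  then obtain xs where xs: "length xs = 4" "sorted_wrt (<) xs" "set xs \<subseteq> {1..n}"
    "\<forall>j<4. \<forall>k<4. \<tau> (xs ! j) < \<tau> (xs ! k) \<longleftrightarrow> [a, b, c, d] ! j < [a, b, c, d] ! k"
    by (auto simp: contains_pattern_def eval_nat_numeral)
  then obtain i j l m where "xs = [i, j, l, m]"
    by (auto simp: eval_nat_numeral length_Suc_conv)
  with xs show ?R
    by (intro exI[of _ i] exI[of _ j] exI[of _ l] exI[of _ m]) (simp add: eval_nat_numeral All_less_Suc)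
next
  assume ?R
  then show ?L
    unfolding contains_pattern_def
    apply (elim exE)
    subgoal for i j l m by (intro exI[of _ "[i, j, l, m]"]) (simp add: All_less_Suc)
    done
qed

lemma
  assumes inj: "inj_on \<tau> {1..n}"
  shows valley_iff_contains:
      "valley n \<tau> \<longleftrightarrow> contains_pattern n \<tau> [2,1,3] \<or> contains_pattern n \<tau> [3,1,2]"
    and peak_iff_contains:
      "valley n (\<lambda>i. - int (\<tau> i)) \<longleftrightarrow> contains_pattern n \<tau> [1,3,2] \<or> contains_pattern n \<tau> [2,3,1]"
proof -
  have ne: "\<tau> i < \<tau> j \<or> \<tau> j < \<tau> i" if "1 \<le> i" "i < j" "j \<le> n" for i j
    using inj_onD[OF inj, of i j] that by (cases "\<tau> i" "\<tau> j" rule: linorder_cases) auto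
  show "valley n \<tau> \<longleftrightarrow> contains_pattern n \<tau> [2,1,3] \<or> contains_pattern n \<tau> [3,1,2]"
  proof
    assume "valley n \<tau>"
    then obtain i j l where *: "1 \<le> i" "i < j" "j < l" "l \<le> n" "\<tau> j < \<tau> i" "\<tau> j < \<tau> l"
      unfolding valley_def by blast
    then have "\<tau> i < \<tau> l \<or> \<tau> l < \<tau> i"
      using ne[of i l] by simp
    with * show "contains_pattern n \<tau> [2,1,3] \<or> contains_pattern n \<tau> [3,1,2]"
      unfolding contains_pattern_3
      by (elim disjE) (rule disjI1 disjI2; intro exI[of _ i] exI[of _ j] exI[of _ l]; force)+
  qed (auto simp: contains_pattern_3 valley_def)
  show "valley n (\<lambda>i. - int (\<tau> i)) \<longleftrightarrow> contains_pattern n \<tau> [1,3,2] \<or> contains_pattern n \<tau> [2,3,1]"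
  proof
    assume "valley n (\<lambda>i. - int (\<tau> i))"
    then obtain i j l where *: "1 \<le> i" "i < j" "j < l" "l \<le> n" "\<tau> i < \<tau> j" "\<tau> l < \<tau> j"
      unfolding valley_def by auto
    then have "\<tau> i < \<tau> l \<or> \<tau> l < \<tau> i"
      using ne[of i l] by simp
    with * show "contains_pattern n \<tau> [1,3,2] \<or> contains_pattern n \<tau> [2,3,1]"
      unfolding contains_pattern_3
      by (elim disjE) (rule disjI1 disjI2; intro exI[of _ i] exI[of _ j] exI[of _ l]; force)+
  qed (auto simp: contains_pattern_3 valley_def)
qed

text \<open>If the inversions share a position, or if \<open>f m < f j\<close> or
  \<open>f l < f i\<close>, three decreasing values appear. Otherwise only the order of
  \<open>f i\<close> and \<open>f m\<close> is open, and it decides between the patterns 2143 and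
  3142.\<close>

lemma two_inversions_cases:
  assumes inj: "inj_on f {1..n}" and "two_inversions n f"
  obtains i j l where "1 \<le> i" "i < j" "j < l" "l \<le> n" "f l < f j" "f j < f i"
  | i j l m where "1 \<le> i" "i < j" "j < l" "l < m" "m \<le> n" "f j < f i" "f i < f m" "f m < f l"
  | i j l m where "1 \<le> i" "i < j" "j < l" "l < m" "m \<le> n" "f j < f m" "f m < f i" "f i < f l"
proof -
  obtain i j l m where *: "1 \<le> i" "i < j" "j \<le> l" "l < m" "m \<le> n" "f j < f i" "f m < f l"
    using assms(2) unfolding two_inversions_def by blast
  have ne: "f i < f j \<or> f j < f i" if "1 \<le> i" "i < j" "j \<le> n" for i j
    using inj_onD[OF inj, of i j] that by (cases "f i" "f j" rule: linorder_cases) auto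
  consider "j = l" | "j < l" "f m < f j" | "j < l" "f l < f i" | "j < l" "f j < f m" "f i < f l"
    using ne[of j m] ne[of i l] * by fastforce
  then show thesis
  proof cases
    case 4
    have "f i < f m \<or> f m < f i"
      using ne[of i m] * by simp
    then show thesis
    proof
      assume "f i < f m"
      then show thesis
        by (intro that(2)[of i j l m]) (use * 4 in auto)
    next
      assume "f m < f i"
      then show thesis
        by (intro that(3)[of i j l m]) (use * 4 in auto)
    qed
  qed (use * that(1)[of i j m] that(1)[of i l m] in auto)
qed

lemma
  assumes inj: "inj_on \<tau> {1..n}"
  shows two_inversions_iff_contains:
      "two_inversions n \<tau> \<longleftrightarrow> contains_pattern n \<tau> [3,2,1] \<or> contains_pattern n \<tau> [2,1,4,3] \<or>
         contains_pattern n \<tau> [3,1,4,2]" (is "_ \<longleftrightarrow> ?P")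
    and two_noninversions_iff_contains:
      "two_inversions n (\<lambda>i. - int (\<tau> i)) \<longleftrightarrow> contains_pattern n \<tau> [1,2,3] \<or>
         contains_pattern n \<tau> [2,4,1,3] \<or> contains_pattern n \<tau> [3,4,1,2]" (is "_ \<longleftrightarrow> ?Q")
proof -
  show "two_inversions n \<tau> \<longleftrightarrow> ?P"
  proof
    assume "two_inversions n \<tau>"
    with inj show ?P
    proof (cases rule: two_inversions_cases)
      case (1 i j l)
      then have "contains_pattern n \<tau> [3,2,1]"
        unfolding contains_pattern_3 by (intro exI[of _ i] exI[of _ j] exI[of _ l]) simp
      then show ?P ..
    next
      case (2 i j l m)
      then have "contains_pattern n \<tau> [2,1,4,3]"
        unfolding contains_pattern_4 by (intro exI[of _ i] exI[of _ j] exI[of _ l] exI[of _ m]) simp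
      then show ?P by blast
    next
      case (3 i j l m)
      then have "contains_pattern n \<tau> [3,1,4,2]"
        unfolding contains_pattern_4 by (intro exI[of _ i] exI[of _ j] exI[of _ l] exI[of _ m]) simp
      then show ?P by blast
    qed
  next
    assume ?P
    then show "two_inversions n \<tau>"
    proof (elim disjE)
      assume "contains_pattern n \<tau> [3,2,1]"
      then obtain i j l where "1 \<le> i" "i < j" "j < l" "l \<le> n" "\<tau> j < \<tau> i" "\<tau> l < \<tau> j"
        unfolding contains_pattern_3 by auto
      then show ?thesis
        unfolding two_inversions_def by (intro exI[of _ i] exI[of _ j] exI[of _ j] exI[of _ l]) auto
    next
      assume "contains_pattern n \<tau> [2,1,4,3]"
      then obtain i j l m where "1 \<le> i" "i < j" "j < l" "l < m" "m \<le> n" "\<tau> j < \<tau> i" "\<tau> m < \<tau> l"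
        unfolding contains_pattern_4 by auto
      then show ?thesis
        unfolding two_inversions_def by (intro exI[of _ i] exI[of _ j] exI[of _ l] exI[of _ m]) auto
    next
      assume "contains_pattern n \<tau> [3,1,4,2]"
      then obtain i j l m where "1 \<le> i" "i < j" "j < l" "l < m" "m \<le> n" "\<tau> j < \<tau> i" "\<tau> m < \<tau> l"
        unfolding contains_pattern_4 by auto
      then show ?thesis
        unfolding two_inversions_def by (intro exI[of _ i] exI[of _ j] exI[of _ l] exI[of _ m]) auto
    qed
  qed
  have inj': "inj_on (\<lambda>i. - int (\<tau> i)) {1..n}"
    using inj by (rule inj_on_uminus_int)
  \<comment> \<open>Negating values complements patterns: 321, 2143 and 3142 become 123, 3412 and
    2413.\<close>
  show "two_inversions n (\<lambda>i. - int (\<tau> i)) \<longleftrightarrow> ?Q"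
  proof
    assume "two_inversions n (\<lambda>i. - int (\<tau> i))"
    with inj' show ?Q
    proof (cases rule: two_inversions_cases)
      case (1 i j l)
      then have "contains_pattern n \<tau> [1,2,3]"
        unfolding contains_pattern_3 by (intro exI[of _ i] exI[of _ j] exI[of _ l]) simp
      then show ?Q ..
    next
      case (2 i j l m)
      then have "contains_pattern n \<tau> [3,4,1,2]"
        unfolding contains_pattern_4 by (intro exI[of _ i] exI[of _ j] exI[of _ l] exI[of _ m]) simp
      then show ?Q by blast
    next
      case (3 i j l m)
      then have "contains_pattern n \<tau> [2,4,1,3]"
        unfolding contains_pattern_4 by (intro exI[of _ i] exI[of _ j] exI[of _ l] exI[of _ m]) simp
      then show ?Q by blast
    qed
  next
    assume ?Q
    then show "two_inversions n (\<lambda>i. - int (\<tau> i))"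
    proof (elim disjE)
      assume "contains_pattern n \<tau> [1,2,3]"
      then obtain i j l where "1 \<le> i" "i < j" "j < l" "l \<le> n" "\<tau> i < \<tau> j" "\<tau> j < \<tau> l"
        unfolding contains_pattern_3 by auto
      then show ?thesis
        unfolding two_inversions_def by (intro exI[of _ i] exI[of _ j] exI[of _ j] exI[of _ l]) auto
    next
      assume "contains_pattern n \<tau> [2,4,1,3]"
      then obtain i j l m where "1 \<le> i" "i < j" "j < l" "l < m" "m \<le> n" "\<tau> i < \<tau> j" "\<tau> l < \<tau> m"
        unfolding contains_pattern_4 by auto
      then show ?thesis
        unfolding two_inversions_def by (intro exI[of _ i] exI[of _ j] exI[of _ l] exI[of _ m]) auto
    next
      assume "contains_pattern n \<tau> [3,4,1,2]"
      then obtain i j l m where "1 \<le> i" "i < j" "j < l" "l < m" "m \<le> n" "\<tau> i < \<tau> j" "\<tau> l < \<tau> m"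
        unfolding contains_pattern_4 by auto
      then show ?thesis
        unfolding two_inversions_def by (intro exI[of _ i] exI[of _ j] exI[of _ l] exI[of _ m]) auto
    qed
  qed
qed

section \<open>The enumeration\<close>

lemma unimodal_splits:
  assumes "\<pi> permutes {1..n}" "n \<ge> 1"
  shows "\<not> valley n \<pi> \<longleftrightarrow> (\<exists>k\<le>n. signed_mono (\<lambda>c. c) n k \<pi>)"
    and "\<not> valley n (\<lambda>i. - int (\<pi> i)) \<longleftrightarrow> (\<exists>k\<le>n. signed_mono Not n k \<pi>)"
    and "\<exists>k\<le>n. signed_mono (\<lambda>c. c) n k \<pi> \<Longrightarrow>
      \<exists>p\<in>{1..n}. \<forall>k. k \<le> n \<and> signed_mono (\<lambda>c. c) n k \<pi> \<longleftrightarrow> k = p \<or> k = p - 1"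
    and "\<exists>k\<le>n. signed_mono Not n k \<pi> \<Longrightarrow>
      \<exists>p\<in>{1..n}. \<forall>k. k \<le> n \<and> signed_mono Not n k \<pi> \<longleftrightarrow> k = p \<or> k = p - 1"
proof -
  have inj: "inj_on \<pi> {1..n}"
    using permutes_inj_on[OF assms(1)] .
  have inj': "inj_on (\<lambda>i. - int (\<pi> i)) {1..n}"
    using inj by (rule inj_on_uminus_int)
  have Not: "signed_mono Not n k \<pi> = signed_mono (\<lambda>c. c) n k (\<lambda>i. - int (\<pi> i))" for k
    using signed_mono_uminus[OF inj, of "\<lambda>c. c"] by simp
  note splits = no_valley_splits[OF assms(2) inj]
  note splits' = no_valley_splits[OF assms(2) inj']
  show 1: "\<not> valley n \<pi> \<longleftrightarrow> (\<exists>k\<le>n. signed_mono (\<lambda>c. c) n k \<pi>)"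
    using signed_mono_imp_no_valley splits by blast
  show 2: "\<not> valley n (\<lambda>i. - int (\<pi> i)) \<longleftrightarrow> (\<exists>k\<le>n. signed_mono Not n k \<pi>)"
    unfolding Not using signed_mono_imp_no_valley splits' by blast
  show "\<exists>p\<in>{1..n}. \<forall>k. k \<le> n \<and> signed_mono (\<lambda>c. c) n k \<pi> \<longleftrightarrow> k = p \<or> k = p - 1"
    if "\<exists>k\<le>n. signed_mono (\<lambda>c. c) n k \<pi>"
    using that 1 by (intro splits) blast
  show "\<exists>p\<in>{1..n}. \<forall>k. k \<le> n \<and> signed_mono Not n k \<pi> \<longleftrightarrow> k = p \<or> k = p - 1"
    if "\<exists>k\<le>n. signed_mono Not n k \<pi>"
    unfolding Not using that 2 by (intro splits') blast
qed

lemma unique_of_parity: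
  assumes "p \<in> {1..n}" "\<And>k. P k \<longleftrightarrow> k = p \<or> k = p - (1::nat)"
  shows "\<exists>!k. P k \<and> odd k" "\<exists>!k. P k \<and> odd (n - k)"
proof -
  have *: "\<exists>!k. P k \<and> Q k" if "Q p \<longleftrightarrow> \<not> Q (p - 1)" for Q
    using that assms(2) by metis
  show "\<exists>!k. P k \<and> odd k"
    by (rule *) (use assms(1) in auto)
  have "n - (p - 1) = Suc (n - p)"
    using assms(1) by auto
  then show "\<exists>!k. P k \<and> odd (n - k)"
    by (intro *) simp
qed

lemma cyclic_avoiders_eq_mono_cycles:
  assumes "n \<ge> 1"
  shows "cyclic_avoiders n {[2,1,3], [3,1,2]} = mono_cycles (\<lambda>c. c) n"
    and "cyclic_avoiders n {[1,3,2], [2,3,1]} = mono_cycles Not n"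
    and "cyclic_avoiders n {[3,2,1], [2,1,4,3], [3,1,4,2]} = mono_cycles (\<lambda>_. False) n"
    and "cyclic_avoiders n {[1,2,3], [2,4,1,3], [3,4,1,2]} = mono_cycles (\<lambda>_. True) n"
proof -
  have
    "avoids_pattern n \<pi> [2,1,3] \<and> avoids_pattern n \<pi> [3,1,2] \<longleftrightarrow>
      (\<exists>k\<le>n. signed_mono (\<lambda>c. c) n k \<pi>)" (is ?A)
    "avoids_pattern n \<pi> [1,3,2] \<and> avoids_pattern n \<pi> [2,3,1] \<longleftrightarrow>
      (\<exists>k\<le>n. signed_mono Not n k \<pi>)" (is ?B)
    "avoids_pattern n \<pi> [3,2,1] \<and> avoids_pattern n \<pi> [2,1,4,3] \<and> avoids_pattern n \<pi> [3,1,4,2] \<longleftrightarrow>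
      (\<exists>k\<le>n. signed_mono (\<lambda>_. False) n k \<pi>)" (is ?C)
    "avoids_pattern n \<pi> [1,2,3] \<and> avoids_pattern n \<pi> [2,4,1,3] \<and> avoids_pattern n \<pi> [3,4,1,2] \<longleftrightarrow>
      (\<exists>k\<le>n. signed_mono (\<lambda>_. True) n k \<pi>)" (is ?D)
    if perm: "\<pi> permutes {1..n}" for \<pi>
  proof -
    have inj: "inj_on \<pi> {1..n}"
      using permutes_inj_on[OF perm] .
    have inj': "inj_on (\<lambda>i. - int (\<pi> i)) {1..n}"
      using inj by (rule inj_on_uminus_int)
    show ?A
      using unimodal_splits(1)[OF perm assms] valley_iff_contains[OF inj]
      by (simp add: avoids_pattern_def)
    show ?B
      using unimodal_splits(2)[OF perm assms] peak_iff_contains[OF inj]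
      by (simp add: avoids_pattern_def)
    show ?C
      using no_two_inversions_iff[OF inj] two_inversions_iff_contains[OF inj]
      by (simp add: avoids_pattern_def)
    show ?D
      using no_two_inversions_iff[OF inj'] two_noninversions_iff_contains[OF inj]
        signed_mono_uminus[OF inj, of "\<lambda>_. False"]
      by (simp add: avoids_pattern_def)
  qed
  then show
    "cyclic_avoiders n {[2,1,3], [3,1,2]} = mono_cycles (\<lambda>c. c) n"
    "cyclic_avoiders n {[1,3,2], [2,3,1]} = mono_cycles Not n"
    "cyclic_avoiders n {[3,2,1], [2,1,4,3], [3,1,4,2]} = mono_cycles (\<lambda>_. False) n"
    "cyclic_avoiders n {[1,2,3], [2,4,1,3], [3,4,1,2]} = mono_cycles (\<lambda>_. True) n"
    unfolding cyclic_avoiders_def mono_cycles_def by (simp_all cong: conj_cong)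
qed

text \<open>A unimodal cycle has two admissible splits, which differ only in the side of the extremal
  point, so exactly one of them gives a word with an odd number of reversing letters. This excludes
  the words \<open>u u\<close>.\<close>

lemma card_unimodal_cycles:
  assumes "n \<ge> 1"
  shows "card (mono_cycles (\<lambda>c. c) n) * n = card {w. primitive n w \<and> par (\<lambda>c. c) w n}"
    and "card (mono_cycles Not n) * n = card {w. primitive n w \<and> par Not w n}"
proof -
  show "card (mono_cycles (\<lambda>c. c) n) * n = card {w. primitive n w \<and> par (\<lambda>c. c) w n}"
  proof (rule card_mono_cycles_unique_odd_split[where Q = "\<lambda>k. odd (n - k)"])
    show "\<exists>!k. (k \<le> n \<and> signed_mono (\<lambda>c. c) n k \<pi>) \<and> odd (n - k)"
      if \<pi>: "\<pi> \<in> mono_cycles (\<lambda>c. c) n" for \<pi>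
    proof -
      obtain p where "p \<in> {1..n}" "\<And>k. k \<le> n \<and> signed_mono (\<lambda>c. c) n k \<pi> \<longleftrightarrow> k = p \<or> k = p - 1"
        using \<pi> unimodal_splits(3)[of \<pi> n] assms unfolding mono_cycles_def by blast
      then show ?thesis
        by (rule unique_of_parity(2))
    qed
  qed (use assms split_cycle.card_itin in \<open>auto simp: par_eq_odd_card\<close>)
  show "card (mono_cycles Not n) * n = card {w. primitive n w \<and> par Not w n}"
  proof (rule card_mono_cycles_unique_odd_split[where Q = odd])
    show "\<exists>!k. (k \<le> n \<and> signed_mono Not n k \<pi>) \<and> odd k"
      if \<pi>: "\<pi> \<in> mono_cycles Not n" for \<pi>
    proof -
      obtain p where "p \<in> {1..n}" "\<And>k. k \<le> n \<and> signed_mono Not n k \<pi> \<longleftrightarrow> k = p \<or> k = p - 1"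
        using \<pi> unimodal_splits(4)[of \<pi> n] assms unfolding mono_cycles_def by blast
      then show ?thesis
        by (rule unique_of_parity(1))
    qed
  qed (use assms split_cycle.k_eq_card in \<open>auto simp: par_eq_odd_card\<close>)
qed

theorem theorem4p1:
  fixes n :: nat
  assumes "n \<ge> 2"
  shows
    "real (card (cyclic_avoiders n {[2,1,3], [3,1,2]})) =
       1 / (2 * real n) * (\<Sum>d | d dvd n \<and> odd d. real_of_int (moebius_mu d) * 2 ^ (n div d)) \<and>
     real (card (cyclic_avoiders n {[1,3,2], [2,3,1]})) =
       1 / (2 * real n) * (\<Sum>d | d dvd n \<and> odd d. real_of_int (moebius_mu d) * 2 ^ (n div d)) \<and>
     real (card (cyclic_avoiders n {[3,2,1], [2,1,4,3], [3,1,4,2]})) =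
       1 / real n * (\<Sum>d | d dvd n. real_of_int (moebius_mu d) * 2 ^ (n div d)) \<and>
     (n \<noteq> 2 \<longrightarrow>
       real (card (cyclic_avoiders n {[1,2,3], [2,4,1,3], [3,4,1,2]})) =
         (if n mod 4 \<noteq> 2
          then 1 / real n * (\<Sum>d | d dvd n. real_of_int (moebius_mu d) * 2 ^ (n div d))
          else 1 / real n * (\<Sum>d | d dvd n. real_of_int (moebius_mu d) * 2 ^ (n div d)) +
               2 / real n * (\<Sum>d | d dvd n div 2. real_of_int (moebius_mu d) * 2 ^ (n div (2 * d)))))"
proof -
  have n: "n \<ge> 1" "n > 0" "n div 2 > 0"
    using assms by auto
  let ?S = "\<Sum>d | d dvd n. real_of_int (moebius_mu d) * 2 ^ (n div d)"
  let ?O = "\<Sum>d | d dvd n \<and> odd d. real_of_int (moebius_mu d) * 2 ^ (n div d)"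
  let ?H = "\<Sum>d | d dvd n div 2. real_of_int (moebius_mu d) * 2 ^ (n div (2 * d))"
  have divide: "real c = x / real n" if "real (c * n) = x" for c x
    using that n by (simp add: field_simps)
  have "real (card (mono_cycles (\<lambda>c. c) n)) = 1 / 2 * ?O / real n"
    using card_primitive_odd[of n "\<lambda>c. c"] n by (intro divide) (simp add: card_unimodal_cycles)
  moreover have "real (card (mono_cycles Not n)) = 1 / 2 * ?O / real n"
    using card_primitive_odd[of n Not] n by (intro divide) (simp add: card_unimodal_cycles)
  moreover have "real (card (mono_cycles (\<lambda>_. False) n)) = ?S / real n"
  proof (rule divide)
    \<comment> \<open>Without reversing letters no \<open>u\<close> has odd parity, so only
      primitive words are codes.\<close>
    have "card (mono_cycles (\<lambda>_. False) n) * n = card {w. primitive n w}"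
      using card_mono_cycles_unique_split[OF unique_split_const] assms
      by (simp add: card_codes par_False)
    then show "real (card (mono_cycles (\<lambda>_. False) n) * n) = ?S"
      using card_primitive[OF n(2)] by simp
  qed
  \<comment> \<open>For \<open>n = 2\<close> the single cycle has the three splits 0, 1, 2 and would
    be counted three times: the right-hand side equals 3 there.\<close>
  moreover have "real (card (mono_cycles (\<lambda>_. True) n)) =
      (if n mod 4 \<noteq> 2 then ?S else ?S + 2 * ?H) / real n" if "n \<noteq> 2"
  proof (rule divide)
    \<comment> \<open>Every letter reverses, so the parity of \<open>u\<close> is that of its length
      \<open>n div 2\<close>. Words \<open>u u\<close> thus occur exactly for
      \<open>n mod 4 = 2\<close>, and each contributes two codes.\<close>
    have "card (mono_cycles (\<lambda>_. True) n) * n =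
        card {w. primitive n w} + (if n mod 4 \<noteq> 2 then 0 else 2 * card {w. primitive (n div 2) w})"
    proof -
      have "n mod 4 = 2 \<longleftrightarrow> even n \<and> odd (n div 2)"
        by presburger
      then show ?thesis
        using card_mono_cycles_unique_split[OF unique_split_const] assms that
        by (auto simp: card_codes par_True)
    qed
    moreover have "real (card {w. primitive (n div 2) w}) = ?H"
      using card_primitive[OF n(3)] by (simp add: div_mult2_eq)
    ultimately show "real (card (mono_cycles (\<lambda>_. True) n) * n) =
        (if n mod 4 \<noteq> 2 then ?S else ?S + 2 * ?H)"
      using card_primitive[OF n(2)] by simp
  qed
  ultimately show ?thesis
    unfolding cyclic_avoiders_eq_mono_cycles[OF n(1)] by (simp add: add_divide_distrib)
qed

end
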